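(* Let $M\ge1$, let $X\subseteq\mathbb{R}$ be an interval, let $s_*\in\mathbb{R}$ and $\psi(x,s)=e^{-(x-s)^2}$. There exists $r>0$ such that for every positive Borel measure $P$ with $\operatorname{card}(\operatorname{supp}P)\ge2M$ and $\operatorname{supp}P\subset[s_*-r,s_*+r]$, in the reconstruction framework defined by $P$ and $\psi$: i) any measure $m_0=\sum_{i=1}^Ma_i\delta_{x_i}$, with $x_1<\dots<x_M$ in the interior of $X$ and $a_i>0$ for all $i$, satisfies the Non-Degenerate Source Condition; ii) any point $x_0$ in the interior of $X$ is $(2M-1)$ Non Degenerate.
   Context: The reconstruction framework defined by a positive measure $P$ on $\mathbb{R}$ and $\psi$ is: $H=L^2(\mathbb{R},P)$ and $\varphi:X\to H$, $\varphi(x)=\psi(x,\cdot)$. $C_0(X)$ is the space of continuous functions $\eta:X\to\mathbb{R}$ such that for every $\varepsilon>0$ there is a compact $K\subset X$ with $|\eta|\le\varepsilon$ on $X\setminus K$. For $k\in\mathbb{N}$, $\mathcal{K}^k(X;H)$ is the set of $\varphi\in C^k(X;H)$ such that $x\mapsto\langle p,\varphi(x)\rangle_H$ belongs to $C_0(X)$ for all $p\in H$ and $\sup_{x\in X}\|\varphi^{(i)}(x)\|_H<\infty$ for $0\le i\le k$. Standing assumption: in every reconstruction framework considered, $\varphi$ is well defined with $\varphi\in\mathcal{K}^k(X;H)$ for some $k\ge2$. For $p\in H$, $(\Phi^*p)(x)=\langle\varphi(x),p\rangle_H$. $\Gamma_x:\mathbb{R}^{2M}\to H$ is $\Gamma_xb=\sum_{i=1}^M(b_{2i-1}\varphi(x_i)+b_{2i}\varphi'(x_i))$.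 If $\Gamma_x$ has full rank (is injective), $p_V$ is the element of minimal norm of $\{p\in H:(\Phi^*p)(x_i)=1,\ (\Phi^*p)'(x_i)=0,\ 1\le i\le M\}$ and $\eta_V=\Phi^*p_V$. The measure $m_0$ satisfies the Non-Degenerate Source Condition if $\Gamma_x$ has full rank, $\eta_V(x)<1$ for all $x\in X\setminus\{x_1,\dots,x_M\}$, and $\eta_V''(x_i)<0$ for all $1\le i\le M$. $F_{2M-1}:\mathbb{R}^{2M}\to H$ is $F_{2M-1}b=\sum_{k=0}^{2M-1}b_{k+1}\varphi^{(k)}(x_0)$. If it has full rank (is injective), $p_W$ is the element of minimal norm of $\{p\in H:(\Phi^*p)(x_0)=1,\ (\Phi^*p)^{(k)}(x_0)=0,\ 1\le k\le2M-1\}$ and $\eta_W=\Phi^*p_W$. The point $x_0$ is $(2M-1)$ Non Degenerate if $\varphi\in\mathcal{K}^{2M}(X;H)$, $F_{2M-1}$ has full rank, $\eta_W^{(2M)}(x_0)<0$, and $\eta_W(x)<1$ for all $x\in X\setminus\{x_0\}$. *)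

theory Defs
  imports "HOL-Analysis.Analysis"
begin

definition measure_support :: "real measure \<Rightarrow> real set" where
  "measure_support P = {s. \<forall>U. open U \<longrightarrow> s \<in> U \<longrightarrow> emeasure P U > 0}"

section \<open>The Hilbert space $L^2(P)$\<close>

text \<open>
  Elements of $L^2(P)$ are represented by square-integrable functions; equality in $L^2(P)$ is
  equality \<open>P\<close>-almost everywhere. Limits and derivatives are taken with respect to the
  $L^2$ (semi)norm, hence do not depend on the representatives.
\<close>

definition L2_space :: "real measure \<Rightarrow> (real \<Rightarrow> real) set" where
  "L2_space P = {f \<in> borel_measurable P. integrable P (\<lambda>s. (f s)\<^sup>2)}"

definition L2_inner :: "real measure \<Rightarrow> (real \<Rightarrow> real) \<Rightarrow> (real \<Rightarrow> real) \<Rightarrow> real" where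
  "L2_inner P f g = (LINT s|P. f s * g s)"

definition L2_norm :: "real measure \<Rightarrow> (real \<Rightarrow> real) \<Rightarrow> real" where
  "L2_norm P f = sqrt (L2_inner P f f)"

definition L2_continuous_on :: "real measure \<Rightarrow> real set \<Rightarrow> (real \<Rightarrow> real \<Rightarrow> real) \<Rightarrow> bool" where
  "L2_continuous_on P X f \<longleftrightarrow>
     (\<forall>x\<in>X. ((\<lambda>y. L2_norm P (\<lambda>s. f y s - f x s)) \<longlongrightarrow> 0) (at x within X))"

text \<open>The derivative is one-sided at an end point of \<open>X\<close> that belongs to \<open>X\<close>.\<close>

definition has_L2_derivative ::
    "real measure \<Rightarrow> real set \<Rightarrow> (real \<Rightarrow> real \<Rightarrow> real) \<Rightarrow> real \<Rightarrow> (real \<Rightarrow> real) \<Rightarrow> bool" where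
  "has_L2_derivative P X f x D \<longleftrightarrow> D \<in> L2_space P \<and>
     ((\<lambda>y. L2_norm P (\<lambda>s. (f y s - f x s) / (y - x) - D s)) \<longlongrightarrow> 0) (at x within X)"

definition L2_deriv ::
    "real measure \<Rightarrow> real set \<Rightarrow> (real \<Rightarrow> real \<Rightarrow> real) \<Rightarrow> real \<Rightarrow> real \<Rightarrow> real" where
  "L2_deriv P X f = (\<lambda>x. SOME D. has_L2_derivative P X f x D)"

abbreviation L2_higher_deriv ::
    "real measure \<Rightarrow> real set \<Rightarrow> nat \<Rightarrow> (real \<Rightarrow> real \<Rightarrow> real) \<Rightarrow> real \<Rightarrow> real \<Rightarrow> real" where
  "L2_higher_deriv P X i f \<equiv> (L2_deriv P X ^^ i) f"

definition L2_C :: "nat \<Rightarrow> real measure \<Rightarrow> real set \<Rightarrow> (real \<Rightarrow> real \<Rightarrow> real) set" where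
  "L2_C k P X = {f.
     (\<forall>i\<le>k. \<forall>x\<in>X. L2_higher_deriv P X i f x \<in> L2_space P) \<and>
     (\<forall>i<k. \<forall>x\<in>X. has_L2_derivative P X (L2_higher_deriv P X i f) x
                        (L2_higher_deriv P X (Suc i) f x)) \<and>
     L2_continuous_on P X (L2_higher_deriv P X k f)}"

section \<open>Reconstruction frameworks\<close>

text \<open>
  A kernel \<open>\<psi>\<close> is curried, so that the map $\varphi(x) = \psi(x,\cdot)$ of the framework defined by
  \<open>P\<close> and \<open>\<psi>\<close> is \<open>\<psi>\<close> itself. Below, \<open>\<phi>\<close> always denotes this map.
\<close>

definition gaussian_kernel :: "real \<Rightarrow> real \<Rightarrow> real" where
  "gaussian_kernel x s = exp (- (x - s)\<^sup>2)"

definition C_zero :: "real set \<Rightarrow> (real \<Rightarrow> real) set" where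
  "C_zero X = {\<eta>. continuous_on X \<eta> \<and>
     (\<forall>\<epsilon>>0. \<exists>K\<subseteq>X. compact K \<and> (\<forall>x\<in>X - K. \<bar>\<eta> x\<bar> \<le> \<epsilon>))}"

definition kernel_class :: "nat \<Rightarrow> real measure \<Rightarrow> real set \<Rightarrow> (real \<Rightarrow> real \<Rightarrow> real) set" where
  "kernel_class k P X = {\<phi> \<in> L2_C k P X.
     (\<forall>p\<in>L2_space P. (\<lambda>x. L2_inner P p (\<phi> x)) \<in> C_zero X) \<and>
     (\<forall>i\<le>k. \<exists>B. \<forall>x\<in>X. L2_norm P (L2_higher_deriv P X i \<phi> x) \<le> B)}"

definition Phi_adj :: "real measure \<Rightarrow> (real \<Rightarrow> real \<Rightarrow> real) \<Rightarrow> (real \<Rightarrow> real) \<Rightarrow> real \<Rightarrow> real" where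
  "Phi_adj P \<phi> p = (\<lambda>x. L2_inner P (\<phi> x) p)"

text \<open>
  Vectors of $\mathbb{R}^n$ are functions on \<open>nat\<close> of which only the values on \<open>{1..n}\<close> matter.
\<close>

definition L2_full_rank :: "real measure \<Rightarrow> nat \<Rightarrow> ((nat \<Rightarrow> real) \<Rightarrow> real \<Rightarrow> real) \<Rightarrow> bool" where
  "L2_full_rank P n T \<longleftrightarrow>
     (\<forall>b c. (AE s in P. T b s = T c s) \<longrightarrow> (\<forall>j\<in>{1..n}. b j = c j))"

section \<open>Non-Degenerate Source Condition\<close>

definition Gamma_op ::
    "real measure \<Rightarrow> real set \<Rightarrow> (real \<Rightarrow> real \<Rightarrow> real) \<Rightarrow> nat \<Rightarrow> (nat \<Rightarrow> real) \<Rightarrow>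
     (nat \<Rightarrow> real) \<Rightarrow> real \<Rightarrow> real" where
  "Gamma_op P X \<phi> M x b =
     (\<lambda>s. \<Sum>i=1..M. b (2*i - 1) * \<phi> (x i) s + b (2*i) * L2_deriv P X \<phi> (x i) s)"

text \<open>
  The certificates $\Phi^* p$ are differentiated at interior points of \<open>X\<close> only, where \<open>deriv\<close>
  depends only on the values on \<open>X\<close>. The minimal norm elements are unique up to
  \<open>P\<close>-null sets, so the choice made by \<open>arg_min_on\<close> does not affect $\eta_V$ and $\eta_W$.
\<close>

definition p_V ::
    "real measure \<Rightarrow> (real \<Rightarrow> real \<Rightarrow> real) \<Rightarrow> nat \<Rightarrow> (nat \<Rightarrow> real) \<Rightarrow> real \<Rightarrow> real" where
  "p_V P \<phi> M x = arg_min_on (L2_norm P)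
     {p \<in> L2_space P. \<forall>i\<in>{1..M}. Phi_adj P \<phi> p (x i) = 1 \<and> deriv (Phi_adj P \<phi> p) (x i) = 0}"

definition eta_V ::
    "real measure \<Rightarrow> (real \<Rightarrow> real \<Rightarrow> real) \<Rightarrow> nat \<Rightarrow> (nat \<Rightarrow> real) \<Rightarrow> real \<Rightarrow> real" where
  "eta_V P \<phi> M x = Phi_adj P \<phi> (p_V P \<phi> M x)"

text \<open>The measure $\sum_{i=1}^M a_i \delta_{x_i}$ on \<open>X\<close>.\<close>

definition spikes :: "real set \<Rightarrow> nat \<Rightarrow> (nat \<Rightarrow> real) \<Rightarrow> (nat \<Rightarrow> real) \<Rightarrow> real measure" where
  "spikes X M a x =
     distr (density (count_space {1..M}) (\<lambda>i. ennreal (a i))) (restrict_space borel X) x"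

text \<open>\<open>M\<close>, \<open>a\<close> and \<open>x\<close> (on \<open>{1..M}\<close>) are determined by the measure \<open>m0\<close>.\<close>

definition NDSC :: "real measure \<Rightarrow> real set \<Rightarrow> (real \<Rightarrow> real \<Rightarrow> real) \<Rightarrow> real measure \<Rightarrow> bool" where
  "NDSC P X \<phi> m0 \<longleftrightarrow> (\<exists>M a x.
     m0 = spikes X M a x \<and> strict_mono_on {1..M} x \<and>
     (\<forall>i\<in>{1..M}. x i \<in> interior X \<and> a i > 0) \<and>
     L2_full_rank P (2*M) (Gamma_op P X \<phi> M x) \<and>
     (\<forall>y\<in>X - x ` {1..M}. eta_V P \<phi> M x y < 1) \<and>
     (\<forall>i\<in>{1..M}. (deriv ^^ 2) (eta_V P \<phi> M x) (x i) < 0))"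

section \<open>Non Degenerate points\<close>

definition F_op ::
    "real measure \<Rightarrow> real set \<Rightarrow> (real \<Rightarrow> real \<Rightarrow> real) \<Rightarrow> nat \<Rightarrow> real \<Rightarrow>
     (nat \<Rightarrow> real) \<Rightarrow> real \<Rightarrow> real" where
  "F_op P X \<phi> n x0 b = (\<lambda>s. \<Sum>k=0..n. b (k + 1) * L2_higher_deriv P X k \<phi> x0 s)"

definition p_W ::
    "real measure \<Rightarrow> (real \<Rightarrow> real \<Rightarrow> real) \<Rightarrow> nat \<Rightarrow> real \<Rightarrow> real \<Rightarrow> real" where
  "p_W P \<phi> n x0 = arg_min_on (L2_norm P)
     {p \<in> L2_space P. Phi_adj P \<phi> p x0 = 1 \<and>
        (\<forall>k\<in>{1..n}. (deriv ^^ k) (Phi_adj P \<phi> p) x0 = 0)}"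

definition eta_W ::
    "real measure \<Rightarrow> (real \<Rightarrow> real \<Rightarrow> real) \<Rightarrow> nat \<Rightarrow> real \<Rightarrow> real \<Rightarrow> real" where
  "eta_W P \<phi> n x0 = Phi_adj P \<phi> (p_W P \<phi> n x0)"

text \<open>Used for odd \<open>n = 2 * M - 1\<close>, so that \<open>n + 1 = 2 * M\<close>.\<close>

definition non_degenerate_point ::
    "nat \<Rightarrow> real measure \<Rightarrow> real set \<Rightarrow> (real \<Rightarrow> real \<Rightarrow> real) \<Rightarrow> real \<Rightarrow> bool" where
  "non_degenerate_point n P X \<phi> x0 \<longleftrightarrow>
     \<phi> \<in> kernel_class (n + 1) P X \<and>
     L2_full_rank P (n + 1) (F_op P X \<phi> n x0) \<and>
     (deriv ^^ (n + 1)) (eta_W P \<phi> n x0) x0 < 0 \<and>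
     (\<forall>y\<in>X - {x0}. eta_W P \<phi> n x0 y < 1)"

end

theory Submission
  imports Defs "HOL-Computational_Algebra.Polynomial"
begin

text \<open>
  The minimal norm solution \<open>p\<close> lies in the span of \<open>2 * M\<close> functions that form a Chebyshev system,
  namely $e^{-s^2}$ times an exponential polynomial, so it has fewer than \<open>2 * M\<close> sign changes. Hence
  there are points $t_1, \dots, t_{2M}$ in $[s_* - r, s_* + r]$ with $p(s) \prod_j (s - t_j) \le 0$ there.
  Put $z = y - s_*$, $g(y) = e^{z^2}(1 - \eta(y))$ and $L = \prod_j (D - 2(t_j - s_*))$. Since
  $e^{z^2} \eta(y) = \int e^{2z(s - s_*)} e^{-(s - s_*)^2} p(s)\,dP(s)$, the function $L g$ is at least $L e^{z^2}$.
  The $2M$-th derivative of $e^{z^2}$ is positive and dominates all the lower ones, so $L e^{z^2} > 0$ for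
  all \<open>z\<close> as soon as \<open>r\<close> is small, depending on \<open>M\<close> only. As \<open>L\<close> is a product of \<open>2 * M\<close> first-order
  operators with real roots, $L g > 0$ and Rolle's theorem determine the sign of the function \<open>g\<close>
  having \<open>2 * M\<close> zeros, counted with multiplicity, at the nodes.
\<close>

section \<open>Products of first-order differential operators\<close>

text \<open>Nodes and interval are not confined to a bounded region, so $L e^{z^2} > 0$ cannot rest
  on z being bounded: the domination of the lower derivatives must hold with one constant for all z.
  With constant 1, what remains is a condition on L alone: the absolute values of its coefficients
  sum to at most $(1+2r)^{2M}$ and the leading one is 1, so $(1+2r)^{2M} < 2$ suffices, whatever P
  is. The weight $e^{z^2}$ turns translates of the Gaussian into pure exponentials in y, which are
  eigenfunctions of every D - t. The number of factors is fixed from two sides: it must be one that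
  the sign changes of p cannot reach, and it must equal the number of interpolation conditions, so
  that Rolle's theorem uses up each of them exactly once. That this number is even gives the defect
  the same sign on both sides of a node. Functions are carried together with their full sequences of
  derivatives. L then acts algebraically on sequences, and linearity alone moves it under the
  integral.\<close>

definition deriv_seq :: "(real \<Rightarrow> nat \<Rightarrow> real) \<Rightarrow> bool" where
  "deriv_seq G \<longleftrightarrow> (\<forall>y i. ((\<lambda>y. G y i) has_real_derivative G y (Suc i)) (at y))"

text \<open>
  For a sequence \<open>G y\<close> of derivatives at \<open>y\<close>, \<open>fold dop ts (G y) 0\<close> is the value at \<open>y\<close> of
  $\prod_{t} (D - t)$ applied to the function.
\<close>

definition dop :: "real \<Rightarrow> (nat \<Rightarrow> real) \<Rightarrow> nat \<Rightarrow> real" where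
  "dop t a = (\<lambda>i. a (Suc i) - t * a i)"

lemma deriv_seq_dop: "deriv_seq G \<Longrightarrow> deriv_seq (\<lambda>y. dop t (G y))"
  unfolding deriv_seq_def dop_def by (intro allI DERIV_diff DERIV_cmult) auto

text \<open>The weight $e^{-ty}$ is the integrating factor of D - t: differentiating $e^{-ty} g$
  gives $e^{-ty} (g' - t g)$. It is positive, so signs and zeros are unaffected by it.\<close>

lemma dop_mvt:
  assumes "deriv_seq G" "a < b"
  obtains \<xi> where "a < \<xi>" "\<xi> < b"
    "exp (- t * b) * G b 0 - exp (- t * a) * G a 0 = (b - a) * (exp (- t * \<xi>) * dop t (G \<xi>) 0)"
proof -
  have "\<exists>\<xi>>a. \<xi> < b \<and> exp (- t * b) * G b 0 - exp (- t * a) * G a 0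
      = (b - a) * (exp (- t * \<xi>) * dop t (G \<xi>) 0)"
  proof (rule MVT2[OF assms(2)])
    fix y
    have "((\<lambda>y. G y 0) has_real_derivative G y (Suc 0)) (at y)"
      using assms(1) by (auto simp: deriv_seq_def)
    then show "((\<lambda>y. exp (- t * y) * G y 0) has_real_derivative
        exp (- t * y) * dop t (G y) 0) (at y)"
      unfolding dop_def by - (rule derivative_eq_intros refl | assumption | simp add: algebra_simps)+
  qed
  then show ?thesis using that by blast
qed

lemma dop_sign:
  assumes "deriv_seq G" "a < b" "c * G a 0 \<le> 0" "0 \<le> c * G b 0"
  obtains \<xi> where "a < \<xi>" "\<xi> < b" "0 \<le> c * dop t (G \<xi>) 0"
proof -
  obtain \<xi> where x: "a < \<xi>" "\<xi> < b"
    and eq: "exp (- t * b) * G b 0 - exp (- t * a) * G a 0 = (b - a) * (exp (- t * \<xi>) * dop t (G \<xi>) 0)"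
    using dop_mvt[OF assms(1,2)] .
  have "0 \<le> exp (- t * b) * (c * G b 0) - exp (- t * a) * (c * G a 0)"
    using mult_nonneg_nonneg[OF exp_ge_zero assms(4), of "- t * b"]
      mult_nonneg_nonpos[OF exp_ge_zero assms(3), of "- t * a"] by linarith
  also have "\<dots> = c * (exp (- t * b) * G b 0 - exp (- t * a) * G a 0)"
    by (simp add: algebra_simps)
  also have "\<dots> = ((b - a) * exp (- t * \<xi>)) * (c * dop t (G \<xi>) 0)"
    unfolding eq by (simp add: algebra_simps)
  finally have "0 \<le> ((b - a) * exp (- t * \<xi>)) * (c * dop t (G \<xi>) 0)" .
  moreover have "0 < (b - a) * exp (- t * \<xi>)" using assms(2) by simp
  ultimately have "0 \<le> c * dop t (G \<xi>) 0"
    by (metis mult_pos_neg not_le)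
  then show ?thesis using that x by blast
qed

lemma dop_rolle:
  assumes "deriv_seq G" "a < b" "G a 0 = 0" "G b 0 = 0"
  obtains \<xi> where "a < \<xi>" "\<xi> < b" "dop t (G \<xi>) 0 = 0"
proof -
  obtain \<xi> where \<xi>: "a < \<xi>" "\<xi> < b"
    "exp (- t * b) * G b 0 - exp (- t * a) * G a 0 = (b - a) * (exp (- t * \<xi>) * dop t (G \<xi>) 0)"
    using dop_mvt[OF assms(1,2)] .
  then have "dop t (G \<xi>) 0 = 0" using assms by simp
  then show ?thesis using that \<xi> by blast
qed

text \<open>Each factor trades the points of an alternating pattern for one point in each gap; the
  new pattern alternates again and still ends in a nonpositive value, until a single point is left.
  Read contrapositively, $L g > 0$ excludes such patterns. The signs are weak, so a zero may stand
  at any place of the pattern.\<close>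

lemma fold_dop_nonpos:
  assumes "deriv_seq G" "\<And>i. i < length ts \<Longrightarrow> s i < s (Suc i)"
    "\<And>i. i \<le> length ts \<Longrightarrow> (- 1) ^ (length ts + i) * G (s i) 0 \<le> 0"
  shows "\<exists>y. fold dop ts (G y) 0 \<le> 0"
  using assms
proof (induction ts arbitrary: G s)
  case Nil
  then show ?case by force
next
  case (Cons t ts)
  let ?m = "length ts"
  have "\<exists>\<xi>. s i < \<xi> \<and> \<xi> < s (Suc i) \<and> 0 \<le> (- 1) ^ (Suc ?m + i) * dop t (G \<xi>) 0" if "i \<le> ?m" for i
  proof -
    have "(- 1) ^ (Suc ?m + i) * G (s i) 0 \<le> 0" "0 \<le> (- 1) ^ (Suc ?m + i) * G (s (Suc i)) 0"
      using Cons.prems(3)[of i] Cons.prems(3)[of "Suc i"] that by auto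
    moreover have "s i < s (Suc i)" using Cons.prems(2)[of i] that by simp
    ultimately obtain \<xi> where "s i < \<xi>" "\<xi> < s (Suc i)"
        "0 \<le> (- 1) ^ (Suc ?m + i) * dop t (G \<xi>) 0"
      using dop_sign[OF Cons.prems(1), of "s i" "s (Suc i)" "(- 1) ^ (Suc ?m + i)" t] by blast
    then show ?thesis by blast
  qed
  then obtain \<xi> where \<xi>: "\<And>i. i \<le> ?m \<Longrightarrow>
      s i < \<xi> i \<and> \<xi> i < s (Suc i) \<and> 0 \<le> (- 1) ^ (Suc ?m + i) * dop t (G (\<xi> i)) 0"
    by metis
  have "\<exists>y. fold dop ts (dop t (G y)) 0 \<le> 0"
  proof (rule Cons.IH)
    show "deriv_seq (\<lambda>y. dop t (G y))" by (rule deriv_seq_dop[OF Cons.prems(1)])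
    show "\<xi> i < \<xi> (Suc i)" if "i < ?m" for i
      using \<xi>[of i] \<xi>[of "Suc i"] that by simp
    show "(- 1) ^ (?m + i) * dop t (G (\<xi> i)) 0 \<le> 0" if "i \<le> ?m" for i
      using \<xi>[OF that] by simp
  qed
  then show ?case by simp
qed

text \<open>Only the first factor is treated by hand. It keeps a zero at each double node and gives
  one signed point in each of the M gaps between the nodes and y: together the 2M points that the
  other 2M - 1 factors require.\<close>

lemma double_nodes_pos:
  assumes G: "deriv_seq G" and pos: "\<And>y. fold dop ts (G y) 0 > 0" and len: "length ts = 2 * M"
    and mono: "strict_mono_on {1..M} x"
    and z: "\<And>i. i \<in> {1..M} \<Longrightarrow> G (x i) 0 = 0 \<and> G (x i) 1 = 0"
    and y: "y \<notin> x ` {1..M}" and M: "M \<ge> 1"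
  shows "G y 0 > 0"
proof (rule ccontr)
  assume "\<not> G y 0 > 0"
  then have gy: "G y 0 \<le> 0" by simp
  obtain t ts' where ts: "ts = t # ts'" and len': "length ts' = 2 * M - 1"
    using len M by (cases ts) auto
  define k where "k = card {i\<in>{1..M}. x i < y}"
  have mono': "x i < x j" if "i \<in> {1..M}" "j \<in> {1..M}" "i < j" for i j
    using mono that by (auto simp: strict_mono_on_def)
  have below: "{i\<in>{1..M}. x i < y} = {1..k}"
  proof -
    let ?S = "{i\<in>{1..M}. x i < y}"
    have "\<exists>n. ?S = {1..n}"
    proof (cases "?S = {}")
      case True
      then show ?thesis by (intro exI[of _ 0]) simp
    next
      case False
      have fin: "finite ?S" by simp
      have n: "Max ?S \<in> ?S" using Max_in[OF fin False] .
      have "i \<in> ?S" if "i \<in> {1..Max ?S}" for i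
      proof (cases "i = Max ?S")
        case False
        then have "x i < x (Max ?S)" using n that by (intro mono') auto
        then show ?thesis using n that by auto
      qed (use n in simp)
      moreover have "i \<in> {1..Max ?S}" if "i \<in> ?S" for i
        using that Max_ge[OF fin that] by simp
      ultimately show ?thesis by blast
    qed
    then obtain n where "?S = {1..n}" by blast
    then show ?thesis unfolding k_def by simp
  qed
  have kM: "k \<le> M" unfolding k_def 
    by (rule order.trans[OF card_mono[of "{1..M}"]]) auto
  have lo: "x i < y" if "1 \<le> i" "i \<le> k" for i
  proof -
    have "i \<in> {i\<in>{1..M}. x i < y}" unfolding below using that by simp
    then show ?thesis by simp
  qed
  have hi: "y < x i" if "k < i" "i \<le> M" for i
  proof -
    have "i \<notin> {i\<in>{1..M}. x i < y}" unfolding below using that by simp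
    moreover have "x i \<noteq> y" using y that by auto
    ultimately show ?thesis using that by auto
  qed
  \<comment> \<open>The nodes with y inserted at position \<open>k\<close>, numbered from 0.\<close>
  define w where "w = (\<lambda>j. if j < k then x (Suc j) else if j = k then y else x j)"
  have w_less: "w j < w (Suc j)" if "j < M" for j
  proof -
    consider "Suc j < k" | "Suc j = k" | "j = k" | "k < j" by linarith
    then show ?thesis
    proof cases
      case 1
      then show ?thesis using mono'[of "Suc j" "Suc (Suc j)"] kM by (simp add: w_def)
    next
      case 2
      then show ?thesis using lo[of k] by (auto simp: w_def)
    next
      case 3
      then show ?thesis using hi[of "Suc k"] that by (simp add: w_def)
    next
      case 4
      then show ?thesis using mono'[of j "Suc j"] that by (simp add: w_def)
    qed
  qed
  have w0: "G (w j) 0 = 0 \<and> dop t (G (w j)) 0 = 0" if "j \<le> M" "j \<noteq> k" for j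
    using that z[of j] z[of "Suc j"] kM by (auto simp: w_def dop_def)
  have wk: "w k = y" by (simp add: w_def)
  \<comment> \<open>The weighted function is zero at the nodes and nonpositive at y. In a gap
    between two nodes either sign is available; the choice by the side of y makes the pattern below
    fit.\<close>
  have "\<exists>\<xi>. w j < \<xi> \<and> \<xi> < w (Suc j) \<and> (if j < k then dop t (G \<xi>) 0 \<le> 0 else 0 \<le> dop t (G \<xi>) 0)"
    if jM: "j < M" for j
  proof (cases "j < k")
    case True
    have "G (w (Suc j)) 0 \<le> 0" using w0[of "Suc j"] jM wk gy by (cases "Suc j = k") auto
    moreover have "G (w j) 0 = 0" using w0[of j] True jM by auto
    ultimately obtain \<xi> where "w j < \<xi>" "\<xi> < w (Suc j)" "0 \<le> (- 1) * dop t (G \<xi>) 0"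
      using dop_sign[OF G w_less[OF jM], of "-1"] by auto
    then show ?thesis using True by auto
  next
    case False
    have "G (w j) 0 \<le> 0" using w0[of j] jM wk gy by (cases "j = k") auto
    moreover have "G (w (Suc j)) 0 = 0" using w0[of "Suc j"] False jM by auto
    ultimately obtain \<xi> where "w j < \<xi>" "\<xi> < w (Suc j)" "0 \<le> 1 * dop t (G \<xi>) 0"
      using dop_sign[OF G w_less[OF jM], of 1] by auto
    then show ?thesis using False by auto
  qed
  then obtain \<xi> where \<xi>: "\<And>j. j < M \<Longrightarrow> w j < \<xi> j \<and> \<xi> j < w (Suc j)"
    and \<xi>s: "\<And>j. j < M \<Longrightarrow> j < k \<Longrightarrow> dop t (G (\<xi> j)) 0 \<le> 0"
      "\<And>j. j < M \<Longrightarrow> \<not> j < k \<Longrightarrow> 0 \<le> dop t (G (\<xi> j)) 0"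
    by metis
  \<comment> \<open>Two points per gap: left of y the node that opens the gap and then the inner
    point, right of y the inner point and then the node that closes it; y itself drops out. Even
    positions then carry values at least 0, odd ones at most 0.\<close>
  define s where "s = (\<lambda>i. if even i then (if i div 2 < k then w (i div 2) else \<xi> (i div 2))
      else (if i div 2 < k then \<xi> (i div 2) else w (Suc (i div 2))))"
  have "\<exists>y. fold dop ts' (dop t (G y)) 0 \<le> 0"
  proof (rule fold_dop_nonpos)
    show "deriv_seq (\<lambda>y. dop t (G y))" by (rule deriv_seq_dop[OF G])
    show "s i < s (Suc i)" if "i < length ts'" for i
    proof (cases "even i")
      case True
      then show ?thesis using \<xi>[of "i div 2"] that len' by (auto simp: s_def)
    next
      case False
      then have e: "Suc i div 2 = Suc (i div 2)" by (simp add: odd_Suc_div_two)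
      have "i div 2 < M" "Suc (i div 2) < M" using that len' False by (auto elim!: oddE)
      then show ?thesis using False e \<xi>[of "i div 2"] \<xi>[of "Suc (i div 2)"] that len'
        by (auto simp: s_def)
    qed
    show "(- 1) ^ (length ts' + i) * dop t (G (s i)) 0 \<le> 0" if "i \<le> length ts'" for i
    proof -
      have i: "i div 2 < M" using that len' M by auto
      have "odd (length ts')" using len' M by auto
      then show ?thesis
        using i \<xi>s[of "i div 2"] w0[of "i div 2"] w0[of "Suc (i div 2)"] 
        by (cases "even i") (auto simp: s_def)
    qed
  qed
  then show False using pos ts by (auto simp: not_le[symmetric])
qed

text \<open>The extra information sits at a node, so two factors are spent first: at a double zero
  the second-order operator returns the second derivative itself, and Rolle's theorem supplies 2M -
  2 further zeros around it.\<close>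

lemma double_nodes_second_deriv_pos:
  assumes G: "deriv_seq G" and pos: "\<And>y. fold dop ts (G y) 0 > 0" and len: "length ts = 2 * M"
    and mono: "strict_mono_on {1..M} x"
    and z: "\<And>i. i \<in> {1..M} \<Longrightarrow> G (x i) 0 = 0 \<and> G (x i) 1 = 0"
    and k: "k \<in> {1..M}"
  shows "G (x k) 2 > 0"
proof (rule ccontr)
  assume "\<not> G (x k) 2 > 0"
  then have gk: "G (x k) 2 \<le> 0" by simp
  obtain t u ts' where ts: "ts = t # u # ts'" and len': "length ts' = 2 * M - 2"
    using len k by (cases ts; cases "tl ts") auto
  have xs: "x (Suc j) < x (Suc (Suc j))" if "Suc j < M" for j
    using mono that by (auto simp: strict_mono_on_def)
  have z': "G (x (Suc j)) 0 = 0 \<and> dop t (G (x (Suc j))) 0 = 0" if "j < M" for j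
    using z[of "Suc j"] that by (auto simp: dop_def)
  have "\<exists>\<xi>. x (Suc j) < \<xi> \<and> \<xi> < x (Suc (Suc j)) \<and> dop t (G \<xi>) 0 = 0" if "Suc j < M" for j
    using dop_rolle[OF G xs[OF that]] z'[of j] z'[of "Suc j"] that by (metis Suc_lessD)
  then obtain \<xi> where \<xi>: "\<And>j. Suc j < M \<Longrightarrow>
      x (Suc j) < \<xi> j \<and> \<xi> j < x (Suc (Suc j)) \<and> dop t (G (\<xi> j)) 0 = 0"
    by metis
  \<comment> \<open>The M nodes at even positions, the M - 1 Rolle zeros at odd ones.\<close>
  define v where "v = (\<lambda>i. if even i then x (Suc (i div 2)) else \<xi> (i div 2))"
  have v_less: "v i < v (Suc i)" if "i < 2 * M - 2" for i
  proof (cases "even i")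
    case True
    then show ?thesis using \<xi>[of "i div 2"] that by (auto simp: v_def)
  next
    case False
    then have e: "Suc i div 2 = Suc (i div 2)" by (simp add: odd_Suc_div_two)
    have "Suc (i div 2) < M" using that False by (auto elim!: oddE)
    then show ?thesis using False e \<xi>[of "i div 2"] by (auto simp: v_def)
  qed
  have v0: "dop t (G (v i)) 0 = 0" if "i \<le> 2 * M - 2" for i
  proof (cases "even i")
    case True
    have "i div 2 < M" using that k by auto
    then show ?thesis using True z'[of "i div 2"] by (auto simp: v_def)
  next
    case False
    have "Suc (i div 2) < M" using that False by (auto elim!: oddE)
    then show ?thesis using False \<xi>[of "i div 2"] by (auto simp: v_def)
  qed
  have "\<exists>\<zeta>. v i < \<zeta> \<and> \<zeta> < v (Suc i) \<and> dop u (dop t (G \<zeta>)) 0 = 0" if "i < 2 * M - 2" for i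
    using dop_rolle[OF deriv_seq_dop[OF G] v_less[OF that], where t=u] v0[of i] v0[of "Suc i"] that
    by (metis less_imp_le Suc_leI)
  then obtain \<zeta> where \<zeta>: "\<And>i. i < 2 * M - 2 \<Longrightarrow>
      v i < \<zeta> i \<and> \<zeta> i < v (Suc i) \<and> dop u (dop t (G (\<zeta> i))) 0 = 0"
    by metis
  \<comment> \<open>The position of \<open>x k\<close> in \<open>v\<close>, nodes being numbered
    from 1. It is even, which is where the pattern asks for a nonpositive value.\<close>
  define m where "m = 2 * (k - 1)"
  have m: "m \<le> 2 * M - 2" "even m" and vm: "v m = x k" using k by (auto simp: m_def v_def)
  define s where "s = (\<lambda>i. if i < m then \<zeta> i else if i = m then x k else \<zeta> (i - 1))"
  have "\<exists>y. fold dop ts' (dop u (dop t (G y))) 0 \<le> 0"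
  proof (rule fold_dop_nonpos)
    show "deriv_seq (\<lambda>y. dop u (dop t (G y)))" by (intro deriv_seq_dop G)
    show "s i < s (Suc i)" if "i < length ts'" for i
    proof -
      consider "Suc i < m" | "Suc i = m" | "i = m" | "m < i" by linarith
      then show ?thesis
      proof cases
        case 1
        then show ?thesis using \<zeta>[of i] \<zeta>[of "Suc i"] m by (simp add: s_def)
      next
        case 2
        then show ?thesis using \<zeta>[of i] m vm by (simp add: s_def)
      next
        case 3
        then show ?thesis using \<zeta>[of i] m vm that len' by (simp add: s_def)
      next
        case 4
        then have "Suc (i - 1) = i" "i - 1 < 2 * M - 2" using that len' by auto
        then show ?thesis using 4 \<zeta>[of i] \<zeta>[of "i - 1"] that len' by (simp add: s_def)
      qed
    qed
    show "(- 1) ^ (length ts' + i) * dop u (dop t (G (s i))) 0 \<le> 0" if "i \<le> length ts'" for i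
    proof (cases "i = m")
      case True
      have "dop u (dop t (G (x k))) 0 = G (x k) 2"
        using z[OF k] by (simp add: dop_def numeral_2_eq_2)
      moreover have "even (length ts' + i)" using True m len' by simp
      ultimately show ?thesis using True gk by (simp add: s_def)
    next
      case False
      then have "dop u (dop t (G (s i))) 0 = 0"
        using \<zeta>[of i] \<zeta>[of "i - 1"] that len' m by (auto simp: s_def)
      then show ?thesis by simp
    qed
  qed
  then show False using pos ts by (auto simp: not_le[symmetric])
qed

text \<open>Inverting D - t from a zero at \<open>x0\<close> is integration against a positive
  weight: the sign is kept on the right and flipped on the left, once per factor.\<close>

lemma single_node_sign:
  assumes "deriv_seq G" "\<And>y. fold dop ts (G y) 0 > 0" "\<And>i. i < length ts \<Longrightarrow> G x0 i = 0"
  shows "x0 < y \<Longrightarrow> G y 0 > 0" "y < x0 \<Longrightarrow> (- 1) ^ length ts * G y 0 > 0"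
proof -
  have "(x0 < y \<longrightarrow> G y 0 > 0) \<and> (y < x0 \<longrightarrow> (- 1) ^ length ts * G y 0 > 0)"
    using assms
  proof (induction ts arbitrary: G y)
    case Nil
    then show ?case by simp
  next
    case (Cons t ts)
    have IH: "(x0 < y \<longrightarrow> dop t (G y) 0 > 0) \<and> (y < x0 \<longrightarrow> (- 1) ^ length ts * dop t (G y) 0 > 0)" for y
      using Cons.prems(3) Cons.prems(2)
      by (intro Cons.IH deriv_seq_dop[OF Cons.prems(1)]) (auto simp: dop_def)
    have 0: "G x0 0 = 0" using Cons.prems(3) by simp
    have "G y 0 > 0" if "x0 < y"
    proof -
      obtain \<xi> where "x0 < \<xi>" "exp (- t * y) * G y 0 - exp (- t * x0) * G x0 0
          = (y - x0) * (exp (- t * \<xi>) * dop t (G \<xi>) 0)"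
        using dop_mvt[OF Cons.prems(1) \<open>x0 < y\<close>] .
      moreover from this IH have "0 < (y - x0) * (exp (- t * \<xi>) * dop t (G \<xi>) 0)"
        using that by simp
      ultimately have "0 < exp (- t * y) * G y 0" using 0 by simp
      then show ?thesis by (metis exp_gt_zero zero_less_mult_pos)
    qed
    moreover have "(- 1) ^ length (t # ts) * G y 0 > 0" if "y < x0"
    proof -
      obtain \<xi> where \<xi>: "\<xi> < x0" "exp (- t * x0) * G x0 0 - exp (- t * y) * G y 0
          = (x0 - y) * (exp (- t * \<xi>) * dop t (G \<xi>) 0)"
        using dop_mvt[OF Cons.prems(1) \<open>y < x0\<close>] .
      have "0 < ((x0 - y) * exp (- t * \<xi>)) * ((- 1) ^ length ts * dop t (G \<xi>) 0)"
        using that IH[of \<xi>] \<xi>(1) by simp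
      also have "\<dots> = exp (- t * y) * ((- 1) ^ length (t # ts) * G y 0)"
        using arg_cong[OF \<xi>(2), of "(*) ((- 1) ^ length ts)"] 0 by (simp add: mult_ac)
      finally show ?thesis by (metis exp_gt_zero zero_less_mult_pos)
    qed
    ultimately show ?case by simp
  qed
  then show "x0 < y \<Longrightarrow> G y 0 > 0" "y < x0 \<Longrightarrow> (- 1) ^ length ts * G y 0 > 0" by auto
qed

lemma fold_dop_vanishing:
  assumes "\<And>i. i < length ts \<Longrightarrow> a i = 0"
  shows "fold dop ts a 0 = a (length ts)"
  using assms
proof (induction ts arbitrary: a)
  case (Cons t ts)
  have "fold dop ts (dop t a) 0 = dop t a (length ts)"
    using Cons.prems by (intro Cons.IH) (auto simp: dop_def)
  moreover have "dop t a (length ts) = a (Suc (length ts))"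
    using Cons.prems[of "length ts"] by (simp add: dop_def)
  ultimately show ?case by simp
qed simp

text \<open>Expanded, the product has coefficients whose absolute values sum to at most
  \<open>(1 + \<rho>) ^ n\<close>; the leading coefficient 1 is the term subtracted.\<close>

lemma fold_dop_bound:
  assumes "\<And>i. i \<le> length ts \<Longrightarrow> \<bar>a i\<bar> \<le> B" "\<And>t. t \<in> set ts \<Longrightarrow> \<bar>t\<bar> \<le> \<rho>" "\<rho> \<ge> 0"
  shows "\<bar>fold dop ts a 0 - a (length ts)\<bar> \<le> ((1 + \<rho>) ^ length ts - 1) * B"
  using assms
proof (induction ts arbitrary: a B)
  case Nil
  then show ?case by simp
next
  case (Cons t ts)
  let ?n = "length ts"
  have B: "B \<ge> 0" using Cons.prems(1)[of 0] by simp
  have t: "\<bar>t * a i\<bar> \<le> \<rho> * B" if "i \<le> Suc ?n" for i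
    using mult_mono[of "\<bar>t\<bar>" \<rho> "\<bar>a i\<bar>" B] Cons.prems(1)[of i] Cons.prems(2)[of t] Cons.prems(3) that
    by (simp add: abs_mult)
  have "\<bar>dop t a i\<bar> \<le> (1 + \<rho>) * B" if "i \<le> ?n" for i
    using Cons.prems(1)[of "Suc i"] t[of i] that by (simp add: dop_def algebra_simps)
  then have "\<bar>fold dop ts (dop t a) 0 - dop t a ?n\<bar> \<le> ((1 + \<rho>) ^ ?n - 1) * ((1 + \<rho>) * B)"
    using Cons.prems(2,3) by (intro Cons.IH) auto
  moreover have "\<bar>dop t a ?n - a (Suc ?n)\<bar> \<le> \<rho> * B"
    using t[of ?n] by (simp add: dop_def)
  ultimately show ?case by (simp add: algebra_simps)
qed

section \<open>Derivatives of the exponential of a square\<close>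

text \<open>The polynomial factor of the \<open>n\<close>-th derivative of $e^{c z^2}$.\<close>

fun exp_square_poly :: "real \<Rightarrow> nat \<Rightarrow> real poly" where
  "exp_square_poly c 0 = 1"
| "exp_square_poly c (Suc n) = pderiv (exp_square_poly c n) + [:0, 2 * c:] * exp_square_poly c n"

lemma deriv_seq_exp_square:
  "deriv_seq (\<lambda>z n. poly (exp_square_poly c n) z * exp (c * z\<^sup>2))"
  unfolding deriv_seq_def
  by (auto intro!: derivative_eq_intros poly_DERIV simp: algebra_simps power2_eq_square)

text \<open>For c = -1 these are the Hermite polynomials up to the sign $(-1)^n$, and this is
  $H_{n+1}' = 2(n+1) H_n$. It replaces the derivative in the definition and so yields the three-term
  recurrence.\<close>

lemma pderiv_exp_square_poly:
  "pderiv (exp_square_poly c (Suc n)) = smult (2 * c * (n + 1)) (exp_square_poly c n)"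
proof (induction n)
  case 0
  then show ?case by (simp add: pderiv_pCons)
next
  case (Suc n)
  have "pderiv (exp_square_poly c (Suc (Suc n)))
      = pderiv (pderiv (exp_square_poly c (Suc n))) + smult (2 * c) (exp_square_poly c (Suc n))
        + [:0, 2 * c:] * pderiv (exp_square_poly c (Suc n))"
    unfolding exp_square_poly.simps(2)[of c "Suc n"] pderiv_add pderiv_mult
    by (simp add: pderiv_pCons del: exp_square_poly.simps)
  also have "\<dots> = smult (2 * c * (n + 1)) (pderiv (exp_square_poly c n) + [:0, 2 * c:] * exp_square_poly c n)
      + smult (2 * c) (exp_square_poly c (Suc n))"
    unfolding Suc.IH pderiv_smult by (simp only: smult_add_right mult_smult_right add_ac)
  also have "\<dots> = smult (2 * c * (n + 1)) (exp_square_poly c (Suc n)) + smult (2 * c) (exp_square_poly c (Suc n))"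
    by (simp only: exp_square_poly.simps(2)[of c n])
  also have "\<dots> = smult (2 * c * (Suc n + 1)) (exp_square_poly c (Suc n))"
    by (simp add: smult_add_left[symmetric] algebra_simps del: exp_square_poly.simps)
  finally show ?case .
qed

lemma exp_square_poly_Suc_Suc:
  "poly (exp_square_poly c (Suc (Suc n))) z
    = 2 * c * z * poly (exp_square_poly c (Suc n)) z + 2 * c * (n + 1) * poly (exp_square_poly c n) z"
  unfolding exp_square_poly.simps(2)[of c "Suc n"] pderiv_exp_square_poly by simp

lemma degree_exp_square_poly:
  assumes "c \<noteq> 0"
  shows "degree (exp_square_poly c n) = n \<and> exp_square_poly c n \<noteq> 0"
proof (induction n)
  case (Suc n)
  let ?p = "exp_square_poly c n"
  have d: "degree ([:0, 2 * c:] * ?p) = Suc n"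
    using Suc assms by (subst degree_mult_eq) auto
  moreover have "degree (pderiv ?p) < Suc n"
    using Suc degree_pderiv[of ?p] by simp
  ultimately have "degree (exp_square_poly c (Suc n)) = Suc n"
    by (simp add: degree_add_eq_right)
  then show ?case by (metis degree_0 nat.distinct(1))
qed simp

text \<open>Induction in steps of two along the three-term recurrence. The sign of
  \<open>z * h (2 * m + 1)\<close> is carried along because it makes the first term of the
  recurrence for \<open>h (2 * m + 2)\<close> nonnegative.\<close>

lemma exp_square_poly_even_dominates:
  fixes z :: real
  defines "h \<equiv> \<lambda>n. poly (exp_square_poly 1 n) z"
  shows "0 < h (2 * m) \<and> 0 \<le> z * h (2 * m + 1) \<and> \<bar>h (2 * m + 1)\<bar> \<le> h (2 * m + 2)
    \<and> h (2 * m) \<le> h (2 * m + 2)"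
proof (induction m)
  case 0
  have "\<bar>2 * z\<bar> \<le> 4 * z\<^sup>2 + 2"
    using zero_le_power2[of "2 * \<bar>z\<bar> - 1"] by (simp add: power2_diff power_mult_distrib abs_mult)
  then show ?case
    by (simp add: h_def numeral_2_eq_2 exp_square_poly_Suc_Suc pderiv_pCons del: exp_square_poly.simps(2))
       (simp add: power2_eq_square pderiv_pCons algebra_simps)
next
  case (Suc m)
  have rec: "h (Suc (Suc n)) = 2 * z * h (Suc n) + 2 * (n + 1) * h n" for n
    unfolding h_def exp_square_poly_Suc_Suc by simp
  define a b where "a = h (2 * m + 1)" and "b = h (2 * m + 2)"
  have b: "0 < b" "\<bar>a\<bar> \<le> b" "0 \<le> z * a" using Suc by (auto simp: a_def b_def)
  have c: "h (2 * m + 3) = 2 * z * b + 2 * (2 * m + 2) * a"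
    using rec[of "2 * m + 1"] by (simp add: a_def b_def numeral_eq_Suc algebra_simps)
  have d: "h (2 * m + 4) = 2 * z * h (2 * m + 3) + 2 * (2 * m + 3) * b"
    using rec[of "2 * m + 2"] by (simp add: a_def b_def numeral_eq_Suc algebra_simps)
  define q where "q = h (2 * m + 3)"
  have zq: "z * q = 2 * (z\<^sup>2 * b) + 2 * (2 * m + 2) * (z * a)"
    unfolding q_def c by (simp add: algebra_simps power2_eq_square)
  have zq0: "0 \<le> z * q"
  proof -
    have "0 \<le> z\<^sup>2 * b" by (rule mult_nonneg_nonneg) (use b in auto)
    moreover have "0 \<le> real (2 * (2 * m + 2)) * (z * a)"
      by (rule mult_nonneg_nonneg) (use b in auto)
    ultimately show ?thesis unfolding zq by simp
  qed
  have d': "h (2 * m + 4) = 2 * (z * q) + (6 * b + 4 * (real m * b))"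
    unfolding d q_def[symmetric] by (simp add: algebra_simps)
  have mb: "0 \<le> real m * b" using b by simp
  have le: "b \<le> h (2 * m + 4)"
    using zq0 b(1) mb unfolding d' by linarith
  have "\<bar>q\<bar> \<le> h (2 * m + 4)"
  \<comment> \<open>For $|z| \<ge> 1/2$ the term 2zq alone is at least |q|. Otherwise |q| is at most
    b + (4m+4) b, which the remaining (6+4m) b covers.\<close>
  proof (cases "\<bar>z\<bar> \<ge> 1/2")
    case True
    have "1/2 * \<bar>q\<bar> \<le> \<bar>z\<bar> * \<bar>q\<bar>" using True by (intro mult_right_mono) auto
    also have "\<dots> = z * q" using zq0 by (simp add: abs_mult[symmetric])
    finally show ?thesis using b(1) mb unfolding d' by linarith
  next
    case False
    have "\<bar>q\<bar> \<le> \<bar>2 * z * b\<bar> + \<bar>2 * (2 * m + 2) * a\<bar>" unfolding q_def c by linarith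
    also have "\<dots> = 2 * (\<bar>z\<bar> * b) + (4 * real m + 4) * \<bar>a\<bar>" using b by (simp add: abs_mult)
    also have "\<dots> \<le> 2 * (1/2 * b) + (4 * real m + 4) * b"
      using False b by (intro add_mono mult_left_mono mult_right_mono) auto
    also have "\<dots> \<le> 6 * b + 4 * (real m * b)" using b by (simp add: algebra_simps)
    finally show ?thesis using zq0 unfolding d' by linarith
  qed
  then show ?case using b zq0 le
    by (simp add: a_def b_def q_def numeral_eq_Suc)
qed

lemma exp_square_poly_le_even:
  assumes "i \<le> 2 * m"
  shows "\<bar>poly (exp_square_poly 1 i) z\<bar> \<le> poly (exp_square_poly 1 (2 * m)) z"
  using assms
proof (induction m)
  case 0
  then show ?case by simp
next
  case (Suc m)
  note dom = exp_square_poly_even_dominates[where z = z and m = m]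
  have "i \<le> 2 * m \<or> i = 2 * m + 1 \<or> i = 2 * m + 2" using Suc.prems by auto
  then consider "i \<le> 2 * m" | "i = 2 * m + 1" | "i = 2 * m + 2" by blast
  then show ?case
  proof cases
    case 1
    then show ?thesis using Suc.IH dom by (simp del: exp_square_poly.simps)
  next
    case 2
    then show ?thesis using dom by (simp del: exp_square_poly.simps)
  next
    case 3
    then show ?thesis using dom by (simp del: exp_square_poly.simps)
  qed
qed

text \<open>The lower-order terms of the operator change the leading derivative by less than its own
  size.\<close>

lemma fold_dop_exp_square_pos:
  assumes "length ts = 2 * m" "\<And>t. t \<in> set ts \<Longrightarrow> \<bar>t\<bar> \<le> \<rho>" "\<rho> \<ge> 0" "(1 + \<rho>) ^ (2 * m) < 2"
  shows "0 < fold dop ts (\<lambda>i. poly (exp_square_poly 1 i) z * exp (z\<^sup>2)) 0"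
proof -
  let ?a = "\<lambda>i. poly (exp_square_poly 1 i) z * exp (z\<^sup>2)"
  let ?B = "?a (2 * m)"
  have "0 < ?B" using exp_square_poly_even_dominates[where z = z and m = m] by simp
  moreover have "\<bar>?a i\<bar> \<le> ?B" if "i \<le> length ts" for i
    using exp_square_poly_le_even[of i m z] that assms(1) by (simp add: abs_mult)
  then have "\<bar>fold dop ts ?a 0 - ?a (length ts)\<bar> \<le> ((1 + \<rho>) ^ length ts - 1) * ?B"
    using assms by (intro fold_dop_bound) auto
  moreover have "((1 + \<rho>) ^ length ts - 1) * ?B < 1 * ?B"
    using \<open>0 < ?B\<close> assms by (intro mult_strict_right_mono) auto
  ultimately show ?thesis using assms(1) by simp
qed

section \<open>Sign changes and zeros\<close>

text \<open>The number counts sign changes, hence one less than the points involved. Weak ordering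
  of the points is enough, since opposite strict signs keep them apart.\<close>

fun alternates :: "(real \<Rightarrow> real) \<Rightarrow> nat \<Rightarrow> real \<Rightarrow> real \<Rightarrow> real \<Rightarrow> bool" where
  "alternates f 0 e a b \<longleftrightarrow> (\<exists>s\<in>{a..b}. e * f s > 0)"
| "alternates f (Suc n) e a b \<longleftrightarrow> (\<exists>s\<in>{a..b}. e * f s > 0 \<and> alternates f n (- e) s b)"

text \<open>One zero per sign change by the intermediate value theorem. Exposing the first point,
  with all zeros to its right, is what guarantees that the next zero found is new.\<close>

lemma alternates_zeros:
  assumes "continuous_on UNIV f" "alternates f n e a b"
  shows "\<exists>s\<in>{a..b}. e * f s > 0 \<and> (\<exists>A. finite A \<and> card A = n \<and> A \<subseteq> {s<..b} \<and> (\<forall>z\<in>A. f z = 0))"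
  using assms(2)
proof (induction n arbitrary: e a)
  case 0
  then show ?case by force
next
  case (Suc n)
  then obtain s where s: "s \<in> {a..b}" "e * f s > 0" and "alternates f n (- e) s b" by auto
  from Suc.IH[OF this(3)] obtain u A where u: "u \<in> {s..b}" "- e * f u > 0"
    and A: "finite A" "card A = n" "A \<subseteq> {u<..b}" "\<forall>z\<in>A. f z = 0" by blast
  have "\<exists>z\<ge>s. z \<le> u \<and> - e * f z = 0"
    using u s by (intro IVT' continuous_intros continuous_on_subset[OF assms(1)]) auto
  then obtain z where z: "s \<le> z" "z \<le> u" "- e * f z = 0" by blast
  then have "f z = 0" "s \<noteq> z" "z \<noteq> u" using s u by auto
  then show ?case using s z A u
    by (intro bexI[of _ s] conjI exI[of _ "insert z A"]) (auto simp: card_insert_if)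
qed

text \<open>
  At most \<open>n - 1\<close> sign changes, padded by end points of the interval where necessary. The padding
  makes it possible to prescribe the overall sign \<open>e\<close>.
\<close>

lemma sign_pattern:
  assumes cont: "continuous_on UNIV f" and "a \<le> b" "\<not> alternates f n e a b"
  shows "\<exists>ts. length ts = n \<and> set ts \<subseteq> {a..b}
    \<and> (\<forall>s\<in>{a..b}. e * f s * (\<Prod>t\<leftarrow>ts. t - s) \<le> 0)"
  using assms(2,3)
proof (induction n arbitrary: e a)
  case 0
  then show ?case by (intro exI[of _ "[]"]) (auto simp: not_less)
next
  case (Suc n)
  let ?S = "{s\<in>{a..b}. e * f s > 0}"
  show ?case
  proof (cases "?S = {}")
    case True
    \<comment> \<open>The padding: f never takes the sign e, so all points go to the right end,
      where every factor is nonnegative.\<close>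
    have "e * f s * (\<Prod>t\<leftarrow>replicate (Suc n) b. t - s) \<le> 0" if "s \<in> {a..b}" for s
    proof (rule mult_nonpos_nonneg)
      show "e * f s \<le> 0" using True that by auto
      show "0 \<le> (\<Prod>t\<leftarrow>replicate (Suc n) b. t - s)" using that by simp
    qed
    then show ?thesis using Suc.prems by (intro exI[of _ "replicate (Suc n) b"]) auto
  next
    case False
    \<comment> \<open>The place where f first takes the sign e. The infimum need not be attained
      with a strict sign, so v itself cannot serve as the first alternation point.\<close>
    define v where "v = Inf ?S"
    have bdd: "bdd_below ?S" by (auto intro: bdd_belowI[of _ a])
    obtain s0 where "s0 \<in> ?S" using False by blast
    then have "v \<le> b" unfolding v_def using cInf_lower[OF _ bdd, of s0] by auto
    moreover have "a \<le> v" unfolding v_def by (rule cInf_greatest[OF False]) auto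
    ultimately have v: "a \<le> v" "v \<le> b" by auto
    have lo: "e * f s \<le> 0" if "s \<in> {a..b}" "s < v" for s
      using cInf_lower[OF _ bdd, of s] that by (fastforce simp: v_def)
    have fv: "0 \<le> e * f v"
    proof -
      have "v \<in> closure ?S" unfolding v_def by (rule closure_contains_Inf[OF False bdd])
      moreover have "closure ?S \<subseteq> {s. 0 \<le> e * f s}"
        by (rule closure_minimal) (auto intro!: closed_Collect_le continuous_intros cont)
      ultimately show ?thesis by blast
    qed
    \<comment> \<open>An alternation beginning with -e starts strictly right of v, because e f is
      nonnegative at v. By the choice of v a point of sign e fits in before it, which would be one
      sign change too many.\<close>
    have "\<not> alternates f n (- e) v b"
    proof
      assume "alternates f n (- e) v b"
      from alternates_zeros[OF cont this] obtain u where u: "u \<in> {v..b}" "- e * f u > 0" by blast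
      have "alternates f n (- e) s b" if "s \<le> v" for s
      proof (cases n)
        case 0
        then show ?thesis using u that by auto
      next
        case (Suc m)
        then show ?thesis using \<open>alternates f n (- e) v b\<close> that by fastforce
      qed
      moreover have "\<exists>s\<in>?S. alternates f n (- e) s b"
      proof (cases n)
        case 0
        have "v \<noteq> u" using u fv by auto
        then have "v < u" using u by simp
        then obtain s where "s \<in> ?S" "s < u" using cInf_lessD[OF False] unfolding v_def by blast
        then show ?thesis using 0 u by (intro bexI[of _ s]) auto
      next
        case (Suc m)
        then obtain w where w: "w \<in> {v..b}" "- e * f w > 0" "alternates f m (- (- e)) w b"
          using \<open>alternates f n (- e) v b\<close> by auto
        have "v \<noteq> w" using w fv by auto
        then have "v < w" using w by simp
        then obtain s where "s \<in> ?S" "s < w" using cInf_lessD[OF False] unfolding v_def by blast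
        then show ?thesis using Suc w by (intro bexI[of _ s]) auto
      qed
      ultimately show False using Suc.prems by auto
    qed
    then obtain ts where ts: "length ts = n" "set ts \<subseteq> {v..b}"
      "\<And>s. s \<in> {v..b} \<Longrightarrow> - e * f s * (\<Prod>t\<leftarrow>ts. t - s) \<le> 0"
      using Suc.IH[of v "- e"] v by blast
    \<comment> \<open>Left of v all factors are nonnegative; right of v the new factor is
      nonpositive and turns the estimate for -e into one for e.\<close>
    have "e * f s * (\<Prod>t\<leftarrow>v # ts. t - s) \<le> 0" if s: "s \<in> {a..b}" for s
    proof (cases "s < v")
      case True
      have "0 \<le> (\<Prod>t\<leftarrow>ts. t - s)"
        using ts(2) True by (intro prod_list_nonneg) auto
      then show ?thesis using True by (intro mult_nonpos_nonneg lo[OF s True]) simp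
    next
      case False
      then have "(v - s) * (- e * f s * (\<Prod>t\<leftarrow>ts. t - s)) \<ge> 0"
        using ts(3)[of s] s by (intro mult_nonpos_nonpos) auto
      then show ?thesis by (simp add: algebra_simps)
    qed
    then show ?thesis using ts v by (intro exI[of _ "v # ts"]) auto
  qed
qed

section \<open>Zeros of exponential polynomials\<close>

text \<open>The clause that each zero lies below some point of A keeps the count right: the next
  zero lies beyond \<open>Max A\<close>, hence beyond all earlier ones.\<close>

lemma rolle_card:
  fixes g :: "real \<Rightarrow> real"
  assumes "\<And>s. (g has_real_derivative g' s) (at s)" "finite A" "\<And>s. s \<in> A \<Longrightarrow> g s = 0"
  shows "\<exists>A'. finite A' \<and> card A \<le> Suc (card A') \<and> (\<forall>z\<in>A'. g' z = 0 \<and> (\<exists>s\<in>A. z < s))"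
  using assms(2,3)
proof (induction rule: finite_linorder_max_induct)
  case empty
  then show ?case by (intro exI[of _ "{}"]) auto
next
  case (insert b A)
  then obtain A' where A': "finite A'" "card A \<le> Suc (card A')"
    "\<forall>z\<in>A'. g' z = 0 \<and> (\<exists>s\<in>A. z < s)" by auto
  show ?case
  proof (cases "A = {}")
    case True
    then show ?thesis by (intro exI[of _ "{}"]) auto
  next
    case False
    have m: "Max A \<in> A" "\<And>s. s \<in> A \<Longrightarrow> s \<le> Max A" using insert False by auto
    have "\<exists>z>Max A. z < b \<and> g b - g (Max A) = (b - Max A) * g' z"
      using insert.hyps(2) m(1) by (intro MVT2 assms(1)) auto
    then obtain z where z: "Max A < z" "z < b" "g b - g (Max A) = (b - Max A) * g' z" by blast
    then have "g' z = 0" using insert.prems m(1) by auto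
    moreover have "z \<notin> A'" using A'(3) m(2) z(1) by force
    moreover have "b \<notin> A" using insert.hyps(2) by auto
    ultimately show ?thesis using A' z insert.hyps
      by (intro exI[of _ "insert z A'"]) auto
  qed
qed

text \<open>Multiplying by $e^{-l_j s}$ and differentiating costs at most one zero and lowers the
  degree bound of \<open>Q j\<close> by one, while no other bound changes. The alternative
  \<open>Q i = 0\<close> admits the bound \<open>m i = 0\<close>.\<close>

lemma exp_poly_zeros:
  fixes Q :: "'i \<Rightarrow> real poly" and l :: "'i \<Rightarrow> real"
  assumes "finite I" "inj_on l I"
    and "\<And>i. i \<in> I \<Longrightarrow> Q i = 0 \<or> degree (Q i) < m i"
    and "finite A" "card A \<ge> (\<Sum>i\<in>I. m i)"
    and "\<And>s. s \<in> A \<Longrightarrow> (\<Sum>i\<in>I. poly (Q i) s * exp (l i * s)) = 0"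
  shows "\<forall>i\<in>I. Q i = 0"
  using assms(3-6)
proof (induction "\<Sum>i\<in>I. m i" arbitrary: Q m A)
  case 0
  then have "\<forall>i\<in>I. m i = 0" using assms(1) by simp
  then show ?case using 0 by auto
next
  case (Suc N)
  then obtain j where j: "j \<in> I" "m j > 0"
    by (metis Zero_not_Suc assms(1) bot_nat_0.not_eq_extremum sum.neutral)
  define Q' where "Q' = (\<lambda>i. pderiv (Q i) + smult (l i - l j) (Q i))"
  define m' where "m' = m(j := m j - 1)"
  define g where "g = (\<lambda>s. exp (- l j * s) * (\<Sum>i\<in>I. poly (Q i) s * exp (l i * s)))"
  define g' where "g' = (\<lambda>s. exp (- l j * s) * (\<Sum>i\<in>I. poly (Q' i) s * exp (l i * s)))"
  have der: "(g has_real_derivative g' s) (at s)" for s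
  proof -
    have "g = (\<lambda>s. \<Sum>i\<in>I. poly (Q i) s * exp ((l i - l j) * s))"
      unfolding g_def sum_distrib_left by (simp add: exp_diff exp_minus algebra_simps divide_simps)
    moreover have "((\<lambda>s. \<Sum>i\<in>I. poly (Q i) s * exp ((l i - l j) * s)) has_real_derivative
      (\<Sum>i\<in>I. poly (Q' i) s * exp ((l i - l j) * s))) (at s)"
      unfolding Q'_def by (intro DERIV_sum)
        (auto intro!: derivative_eq_intros poly_DERIV simp: algebra_simps)
    moreover have "(\<Sum>i\<in>I. poly (Q' i) s * exp ((l i - l j) * s)) = g' s"
      unfolding g'_def sum_distrib_left by (simp add: exp_diff exp_minus algebra_simps divide_simps)
    ultimately show ?thesis by simp
  qed
  have "g s = 0" if "s \<in> A" for s using Suc.prems(4)[OF that] by (simp add: g_def)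
  from rolle_card[OF der Suc.prems(2) this] obtain A' where A': "finite A'" "card A \<le> Suc (card A')"
    "\<forall>z\<in>A'. g' z = 0" by blast
  have summ: "(\<Sum>i\<in>I. m i) = Suc (\<Sum>i\<in>I. m' i)"
    using j assms(1) by (simp add: m'_def sum.remove)
  have Q': "\<forall>i\<in>I. Q' i = 0"
  proof (rule Suc.hyps(1))
    show "N = (\<Sum>i\<in>I. m' i)" using summ Suc.hyps(2) by simp
    show "Q' i = 0 \<or> degree (Q' i) < m' i" if i: "i \<in> I" for i
    proof (cases "i = j")
      case True
      have "pderiv (Q j) = 0 \<or> degree (pderiv (Q j)) < m j - 1"
        using Suc.prems(1)[OF j(1)] degree_pderiv[of "Q j"] pderiv_eq_0_iff[of "Q j"] by auto
      then show ?thesis using True by (simp add: Q'_def m'_def)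
    next
      case False
      have "degree (Q' i) \<le> degree (Q i)" unfolding Q'_def
        by (rule degree_add_le) (auto simp: degree_pderiv intro: order.trans[OF degree_smult_le])
      then show ?thesis using Suc.prems(1)[OF i] False by (auto simp: Q'_def m'_def)
    qed
    show "finite A'" by fact
    show "(\<Sum>i\<in>I. m' i) \<le> card A'" using A' Suc.prems(3) summ by simp
    show "(\<Sum>i\<in>I. poly (Q' i) s * exp (l i * s)) = 0" if "s \<in> A'" for s
      using A'(3) that by (auto simp: g'_def)
  qed
  \<comment> \<open>Otherwise \<open>Q i\<close> would be a nonzero multiple of its own derivative,
    which the degrees forbid. The frequencies must be distinct for this.\<close>
  have other: "Q i = 0" if "i \<in> I" "i \<noteq> j" for i
  proof (rule ccontr)
    assume "Q i \<noteq> 0"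
    have "l i - l j \<noteq> 0" using assms(2) that j by (auto dest: inj_onD)
    have "pderiv (Q i) = - smult (l i - l j) (Q i)"
      using Q' that by (simp add: Q'_def eq_neg_iff_add_eq_0)
    then have "degree (pderiv (Q i)) = degree (Q i)" using \<open>l i - l j \<noteq> 0\<close> by simp
    then have "degree (Q i) = 0" by (simp add: degree_pderiv)
    then have "pderiv (Q i) = 0" by (simp add: pderiv_eq_0_iff)
    then show False using Q' that \<open>l i - l j \<noteq> 0\<close> \<open>Q i \<noteq> 0\<close> by (auto simp: Q'_def)
  qed
  have "pderiv (Q j) = 0" using Q' j by (auto simp: Q'_def)
  then obtain c where c: "Q j = [:c:]" using degree_eq_zeroE[of "Q j"] by (auto simp: pderiv_eq_0_iff)
  have "card A > 0" using Suc.prems(3) Suc.hyps(2) by linarith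
  then obtain s where "s \<in> A" by (metis card.empty equals0I less_irrefl)
  have "0 = (\<Sum>i\<in>I. poly (Q i) s * exp (l i * s))" using Suc.prems(4)[OF \<open>s \<in> A\<close>] by simp
  also have "\<dots> = poly (Q j) s * exp (l j * s)"
    using assms(1) j other by (subst sum.remove[of _ j]) auto
  finally have "Q j = 0" using c by simp
  then show ?case using other by auto
qed

section \<open>Minimal norm elements of $L^2(P)$\<close>

lemma L2_space_D:
  assumes "f \<in> L2_space P"
  shows "f \<in> borel_measurable P" "integrable P (\<lambda>s. (f s)\<^sup>2)"
  using assms by (auto simp: L2_space_def)

lemma L2_space_integrable_mult:
  assumes f: "f \<in> L2_space P" and g: "g \<in> L2_space P"
  shows "integrable P (\<lambda>s. f s * g s)"
proof (rule Bochner_Integration.integrable_bound)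
  show "integrable P (\<lambda>s. (f s)\<^sup>2 + (g s)\<^sup>2)"
    using L2_space_D[OF f] L2_space_D[OF g] by simp
  show "(\<lambda>s. f s * g s) \<in> borel_measurable P"
    using L2_space_D[OF f] L2_space_D[OF g] by simp
  have "\<bar>f s * g s\<bar> \<le> (f s)\<^sup>2 + (g s)\<^sup>2" for s
  proof -
    have "2 * (\<bar>f s\<bar> * \<bar>g s\<bar>) \<le> (f s)\<^sup>2 + (g s)\<^sup>2"
      using zero_le_power2[of "\<bar>f s\<bar> - \<bar>g s\<bar>"] by (simp add: power2_diff)
    moreover have "0 \<le> \<bar>f s\<bar> * \<bar>g s\<bar>" by simp
    ultimately show ?thesis unfolding abs_mult by linarith
  qed
  then show "AE s in P. norm (f s * g s) \<le> norm ((f s)\<^sup>2 + (g s)\<^sup>2)" by auto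
qed

lemma L2_space_zero [simp]: "(\<lambda>s. 0) \<in> L2_space P"
  by (simp add: L2_space_def)

lemma L2_space_cmult: "f \<in> L2_space P \<Longrightarrow> (\<lambda>s. c * f s) \<in> L2_space P"
  by (auto simp: L2_space_def power_mult_distrib)

lemma L2_space_add:
  assumes f: "f \<in> L2_space P" and g: "g \<in> L2_space P"
  shows "(\<lambda>s. f s + g s) \<in> L2_space P"
proof -
  have "integrable P (\<lambda>s. (f s)\<^sup>2 + (g s)\<^sup>2 + 2 * (f s * g s))"
    using L2_space_D[OF f] L2_space_D[OF g] L2_space_integrable_mult[OF f g] by auto
  then show ?thesis
    using L2_space_D[OF f] L2_space_D[OF g] by (simp add: L2_space_def power2_sum mult.assoc)
qed

lemma L2_space_diff:
  assumes "f \<in> L2_space P" "g \<in> L2_space P"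
  shows "(\<lambda>s. f s - g s) \<in> L2_space P"
  using L2_space_add[OF assms(1) L2_space_cmult[OF assms(2), of "-1"]] by simp

lemma L2_space_sum:
  assumes "\<And>j. j \<in> J \<Longrightarrow> v j \<in> L2_space P"
  shows "(\<lambda>s. \<Sum>j\<in>J. b j * v j s) \<in> L2_space P"
proof (cases "finite J")
  case True
  then show ?thesis using assms
    by (induction J) (auto intro!: L2_space_add L2_space_cmult)
qed simp

lemma L2_inner_commute: "L2_inner P f g = L2_inner P g f"
  by (simp add: L2_inner_def mult.commute)

lemma L2_inner_add:
  assumes "f \<in> L2_space P" "g \<in> L2_space P" "h \<in> L2_space P"
  shows "L2_inner P f (\<lambda>s. g s + h s) = L2_inner P f g + L2_inner P f h"
  using L2_space_integrable_mult[OF assms(1,2)] L2_space_integrable_mult[OF assms(1,3)]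
  by (simp add: L2_inner_def distrib_left)

lemma L2_inner_cmult: "L2_inner P f (\<lambda>s. c * g s) = c * L2_inner P f g"
  by (simp add: L2_inner_def mult.left_commute)

lemma L2_inner_diff:
  assumes "f \<in> L2_space P" "g \<in> L2_space P" "h \<in> L2_space P"
  shows "L2_inner P f (\<lambda>s. g s - h s) = L2_inner P f g - L2_inner P f h"
  using L2_space_integrable_mult[OF assms(1,2)] L2_space_integrable_mult[OF assms(1,3)]
  by (simp add: L2_inner_def right_diff_distrib)

lemma L2_inner_sum:
  assumes "f \<in> L2_space P" "\<And>j. j \<in> J \<Longrightarrow> v j \<in> L2_space P"
  shows "L2_inner P f (\<lambda>s. \<Sum>j\<in>J. b j * v j s) = (\<Sum>j\<in>J. b j * L2_inner P f (v j))"
proof -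
  have "L2_inner P f (\<lambda>s. \<Sum>j\<in>J. b j * v j s) = (LINT s|P. (\<Sum>j\<in>J. b j * (f s * v j s)))"
    by (simp add: L2_inner_def sum_distrib_left mult_ac)
  also have "\<dots> = (\<Sum>j\<in>J. b j * L2_inner P f (v j))"
    using L2_space_integrable_mult[OF assms(1) assms(2)]
    by (subst Bochner_Integration.integral_sum) (auto simp: L2_inner_def)
  finally show ?thesis .
qed

lemma L2_inner_self_nonneg: "0 \<le> L2_inner P f f"
  by (simp add: L2_inner_def)

lemma L2_inner_self_eq_0_iff:
  assumes "f \<in> L2_space P"
  shows "L2_inner P f f = 0 \<longleftrightarrow> (AE s in P. f s = 0)"
  using L2_space_D[OF assms] integral_nonneg_eq_0_iff_AE[of P "\<lambda>s. (f s)\<^sup>2"]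
  by (simp add: L2_inner_def power2_eq_square)

definition L2_independent :: "real measure \<Rightarrow> nat \<Rightarrow> (nat \<Rightarrow> real \<Rightarrow> real) \<Rightarrow> bool" where
  "L2_independent P n v \<longleftrightarrow>
     (\<forall>b. (AE s in P. (\<Sum>j=1..n. b j * v j s) = 0) \<longrightarrow> (\<forall>j\<in>{1..n}. b j = 0))"

text \<open>Gram-Schmidt in inductive form: u is the part of the last vector orthogonal to the
  others, nonzero by independence. A multiple of u corrects the last equation and leaves the earlier
  ones alone.\<close>

lemma gram_system_solvable:
  assumes "\<And>j. j \<in> {1..n} \<Longrightarrow> v j \<in> L2_space P" "L2_independent P n v"
  shows "\<exists>b. \<forall>j\<in>{1..n}. L2_inner P (v j) (\<lambda>s. \<Sum>i=1..n. b i * v i s) = c j"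
  using assms
proof (induction n arbitrary: c)
  case 0
  then show ?case by simp
next
  case (Suc n)
  have L2: "v j \<in> L2_space P" if "j \<in> {1..Suc n}" for j using Suc.prems(1)[OF that] .
  have "L2_independent P n v"
    unfolding L2_independent_def
  proof (intro allI impI)
    fix b assume "AE s in P. (\<Sum>j=1..n. b j * v j s) = 0"
    moreover have "(\<Sum>j=1..Suc n. (b(Suc n := 0)) j * v j s) = (\<Sum>j=1..n. b j * v j s)" for s
      by (auto intro!: sum.cong)
    ultimately have "AE s in P. (\<Sum>j=1..Suc n. (b(Suc n := 0)) j * v j s) = 0"
      by simp
    then have "\<forall>j\<in>{1..Suc n}. (b(Suc n := 0)) j = 0"
      using Suc.prems(2) unfolding L2_independent_def by blast
    then show "\<forall>j\<in>{1..n}. b j = 0" by force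
  qed
  then have IH: "\<exists>b. \<forall>j\<in>{1..n}. L2_inner P (v j) (\<lambda>s. \<Sum>i=1..n. b i * v i s) = c j" for c
    using L2 by (intro Suc.IH) auto
  obtain a where a: "\<And>j. j \<in> {1..n} \<Longrightarrow>
      L2_inner P (v j) (\<lambda>s. \<Sum>i=1..n. a i * v i s) = L2_inner P (v j) (v (Suc n))"
    using IH[of "\<lambda>j. L2_inner P (v j) (v (Suc n))"] by blast
  obtain b where b: "\<And>j. j \<in> {1..n} \<Longrightarrow> L2_inner P (v j) (\<lambda>s. \<Sum>i=1..n. b i * v i s) = c j"
    using IH[of c] by blast
  define w where "w = (\<lambda>s. \<Sum>i=1..n. b i * v i s)"
  define p where "p = (\<lambda>s. \<Sum>i=1..n. a i * v i s)"
  define u where "u = (\<lambda>s. v (Suc n) s - p s)"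
  have vn: "v (Suc n) \<in> L2_space P" using L2 by simp
  have p: "p \<in> L2_space P" unfolding p_def using L2 by (intro L2_space_sum) auto
  have w: "w \<in> L2_space P" unfolding w_def using L2 by (intro L2_space_sum) auto
  have u: "u \<in> L2_space P" unfolding u_def by (intro L2_space_diff vn p)
  have orth: "L2_inner P (v j) u = 0" if "j \<in> {1..n}" for j
    using a[OF that] L2[of j] that L2_inner_diff[OF _ vn p, of "v j"] by (simp add: u_def p_def)
  have "L2_inner P u p = 0"
    unfolding p_def using L2 orth
    by (subst L2_inner_sum[OF u]) (auto simp: L2_inner_commute[of P u])
  moreover have "L2_inner P u u = L2_inner P u (v (Suc n)) - L2_inner P u p"
    using L2_inner_diff[OF u vn p] by (simp add: u_def)
  ultimately have uu: "L2_inner P (v (Suc n)) u = L2_inner P u u"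
    by (simp add: L2_inner_commute)
  have "L2_inner P u u \<noteq> 0"
  proof
    assume "L2_inner P u u = 0"
    then have "AE s in P. u s = 0" using L2_inner_self_eq_0_iff[OF u] by simp
    moreover define a' where "a' = (\<lambda>i. if i = Suc n then 1 else - a i)"
    have "(\<Sum>j=1..Suc n. a' j * v j s) = u s" for s
      by (simp add: a'_def u_def p_def sum_negf[symmetric])
    ultimately have "AE s in P. (\<Sum>j=1..Suc n. a' j * v j s) = 0"
      by simp
    then have "\<forall>j\<in>{1..Suc n}. a' j = 0"
      using Suc.prems(2) unfolding L2_independent_def by blast
    then have "a' (Suc n) = 0" by (rule bspec) simp
    then show False by (simp add: a'_def)
  qed
  define k where "k = (c (Suc n) - L2_inner P (v (Suc n)) w) / L2_inner P u u"
  define d where "d = (\<lambda>i. if i = Suc n then k else b i - k * a i)"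
  have d: "(\<lambda>s. \<Sum>i=1..Suc n. d i * v i s) = (\<lambda>s. w s + k * u s)"
    by (auto simp: d_def w_def u_def p_def algebra_simps sum_distrib_left sum_subtractf)
  have ku: "(\<lambda>s. k * u s) \<in> L2_space P" using u by (rule L2_space_cmult)
  have "L2_inner P (v j) (\<lambda>s. w s + k * u s) = c j" if j: "j \<in> {1..Suc n}" for j
  proof -
    have *: "L2_inner P (v j) (\<lambda>s. w s + k * u s) = L2_inner P (v j) w + k * L2_inner P (v j) u"
      using L2_inner_add[OF L2[OF j] w ku] by (simp add: L2_inner_cmult)
    show ?thesis
    proof (cases "j = Suc n")
      case True
      then show ?thesis using * uu \<open>L2_inner P u u \<noteq> 0\<close> by (simp add: k_def)
    next
      case False
      then have "j \<in> {1..n}" using j by auto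
      then show ?thesis using * orth b by (simp add: w_def)
    qed
  qed
  then show ?case using d by (intro exI[of _ d]) simp
qed

text \<open>The Gram system has a solution q in the span. Feasible elements differ from q by
  something orthogonal to the span, so by Pythagoras q is minimal and every minimizer agrees with q
  almost everywhere.\<close>

lemma arg_min_L2_norm_in_span:
  fixes c :: "nat \<Rightarrow> real"
  assumes L2: "\<And>j. j \<in> {1..n} \<Longrightarrow> v j \<in> L2_space P" and ind: "L2_independent P n v"
  defines "S \<equiv> {p \<in> L2_space P. \<forall>j\<in>{1..n}. L2_inner P (v j) p = c j}"
  shows "arg_min_on (L2_norm P) S \<in> S"
    "\<exists>b. AE s in P. arg_min_on (L2_norm P) S s = (\<Sum>j=1..n. b j * v j s)"
proof -
  obtain b where b: "\<And>j. j \<in> {1..n} \<Longrightarrow> L2_inner P (v j) (\<lambda>s. \<Sum>i=1..n. b i * v i s) = c j"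
    using gram_system_solvable[OF L2 ind] by blast
  define q where "q = (\<lambda>s. \<Sum>i=1..n. b i * v i s)"
  have q: "q \<in> L2_space P" unfolding q_def using L2 by (intro L2_space_sum) auto
  have qS: "q \<in> S" using q b by (auto simp: S_def q_def)
  have pyth: "L2_inner P p p = L2_inner P q q + L2_inner P (\<lambda>s. p s - q s) (\<lambda>s. p s - q s)"
    if "p \<in> S" for p
  proof -
    have p: "p \<in> L2_space P" using that by (simp add: S_def)
    define e where "e = (\<lambda>s. p s - q s)"
    have e: "e \<in> L2_space P" unfolding e_def by (intro L2_space_diff p q)
    have "L2_inner P (v j) e = 0" if "j \<in> {1..n}" for j
      using L2_inner_diff[OF L2[OF that] p q] \<open>p \<in> S\<close> qS that by (simp add: S_def e_def)
    then have "L2_inner P e q = 0"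
      unfolding q_def by (subst L2_inner_sum[OF e L2]) (auto simp: L2_inner_commute[of P e])
    moreover have "L2_inner P p p = L2_inner P q q + 2 * L2_inner P e q + L2_inner P e e"
    proof -
      have pe: "p = (\<lambda>s. q s + e s)" by (auto simp: e_def)
      have "L2_inner P p p = L2_inner P p q + L2_inner P p e"
        using L2_inner_add[OF p q e] pe by simp
      moreover have "L2_inner P p q = L2_inner P q q + L2_inner P q e"
        using L2_inner_add[OF q q e] pe by (simp add: L2_inner_commute)
      moreover have "L2_inner P p e = L2_inner P e q + L2_inner P e e"
        using L2_inner_add[OF e q e] pe by (simp add: L2_inner_commute)
      ultimately show ?thesis by (simp add: L2_inner_commute)
    qed
    ultimately show ?thesis by (simp add: e_def)
  qed
  have min: "L2_norm P q \<le> L2_norm P p" if "p \<in> S" for p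
    using pyth[OF that] L2_inner_self_nonneg[of P "\<lambda>s. p s - q s"] by (simp add: L2_norm_def)
  define m where "m = arg_min_on (L2_norm P) S"
  \<comment> \<open>The choice made by \<open>arg_min_on\<close> is known to be a minimizer only
    once some minimizer is exhibited.\<close>
  have "is_arg_min (L2_norm P) (\<lambda>p. p \<in> S) q"
    using qS min by (auto simp: is_arg_min_def not_less)
  then have "is_arg_min (L2_norm P) (\<lambda>p. p \<in> S) m"
    unfolding m_def arg_min_on_def arg_min_def
    using someI[of "is_arg_min (L2_norm P) (\<lambda>p. p \<in> S)" q] by blast
  then have mS: "m \<in> S" and "L2_norm P m \<le> L2_norm P q"
    using qS by (auto simp: is_arg_min_def not_less)
  then have "L2_inner P m m \<le> L2_inner P q q" by (simp add: L2_norm_def)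
  then have "L2_inner P (\<lambda>s. m s - q s) (\<lambda>s. m s - q s) = 0"
    using pyth[OF mS] L2_inner_self_nonneg[of P "\<lambda>s. m s - q s"] by simp
  moreover have "(\<lambda>s. m s - q s) \<in> L2_space P"
    using mS q by (intro L2_space_diff) (auto simp: S_def)
  ultimately have "AE s in P. m s = q s" using L2_inner_self_eq_0_iff by fastforce
  then show "\<exists>b. AE s in P. arg_min_on (L2_norm P) S s = (\<Sum>j=1..n. b j * v j s)"
    unfolding m_def q_def by blast
  show "arg_min_on (L2_norm P) S \<in> S" using mS by (simp add: m_def)
qed

section \<open>Derivatives of the Gaussian kernel\<close>

text \<open>Up to the sign $(-1)^k$ the Hermite polynomial $H_k(x-s)$ times the Gaussian. It is a
  fixed pointwise representative of the derivatives that \<open>L2_deriv\<close> determines only up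
  to null sets.\<close>

definition gauss_deriv :: "nat \<Rightarrow> real \<Rightarrow> real \<Rightarrow> real" where
  "gauss_deriv k x s = poly (exp_square_poly (- 1) k) (x - s) * exp (- (x - s)\<^sup>2)"

lemma gauss_deriv_0: "gauss_deriv 0 = gaussian_kernel"
  by (intro ext) (simp add: gauss_deriv_def gaussian_kernel_def)

lemma deriv_seq_gauss: "deriv_seq (\<lambda>x k. gauss_deriv k x s)"
  unfolding deriv_seq_def
proof (intro allI)
  fix y i
  have "((\<lambda>z. poly (exp_square_poly (- 1) i) z * exp (- 1 * z\<^sup>2)) has_real_derivative
      poly (exp_square_poly (- 1) (Suc i)) (y + - s) * exp (- 1 * (y + - s)\<^sup>2)) (at (y + - s))"
    using deriv_seq_exp_square[of "- 1"] unfolding deriv_seq_def by blast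
  then show "((\<lambda>x. gauss_deriv i x s) has_real_derivative gauss_deriv (Suc i) y s) (at y)"
    unfolding DERIV_shift gauss_deriv_def by (simp del: exp_square_poly.simps)
qed

lemma DERIV_gauss_deriv:
  "((\<lambda>x. gauss_deriv k x s) has_real_derivative gauss_deriv (Suc k) x s) (at x within X)"
  using deriv_seq_gauss[of s] unfolding deriv_seq_def by (blast intro: has_field_derivative_at_within)

lemma continuous_gauss_deriv: "continuous_on UNIV (gauss_deriv k x)"
  unfolding gauss_deriv_def by (intro continuous_intros)

text \<open>Each new factor u spends half of the exponent, so the induction needs c
  arbitrary.\<close>

lemma poly_le_exp_square:
  fixes q :: "real poly"
  assumes "c > 0"
  shows "\<exists>B. \<forall>u. \<bar>poly q u\<bar> \<le> B * exp (c * u\<^sup>2)"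
  using assms
proof (induction q arbitrary: c)
  case 0
  then show ?case by (intro exI[of _ 0]) simp
next
  case (pCons a q)
  obtain B where B: "\<And>u. \<bar>poly q u\<bar> \<le> B * exp (c / 2 * u\<^sup>2)"
    using pCons.IH[of "c / 2"] pCons.prems by auto
  have "\<bar>poly (pCons a q) u\<bar> \<le> (\<bar>a\<bar> + (1 + 2 / c) * B) * exp (c * u\<^sup>2)" for u
  proof -
    let ?e = "exp (c / 2 * u\<^sup>2)"
    have ee: "?e * ?e = exp (c * u\<^sup>2)" by (simp add: exp_add[symmetric])
    have e1: "1 \<le> exp (c * u\<^sup>2)" using pCons.prems by simp
    have e2: "1 + c / 2 * u\<^sup>2 \<le> ?e" by (rule exp_ge_add_one_self)
    have "1 \<le> ?e" using pCons.prems by simp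
    moreover have "u\<^sup>2 \<le> 2 / c * ?e"
      using e2 pCons.prems by (simp add: field_simps)
    moreover have "\<bar>u\<bar> \<le> 1 + u\<^sup>2"
    proof -
      have "2 * \<bar>u\<bar> \<le> 1 + u\<^sup>2" using zero_le_power2[of "\<bar>u\<bar> - 1"] by (simp add: power2_diff)
      then show ?thesis by linarith
    qed
    ultimately have u: "\<bar>u\<bar> \<le> (1 + 2 / c) * ?e" unfolding distrib_right by linarith
    have "\<bar>u\<bar> * \<bar>poly q u\<bar> \<le> ((1 + 2 / c) * ?e) * (B * ?e)"
      using u B pCons.prems by (intro mult_mono) auto
    also have "\<dots> = (1 + 2 / c) * B * exp (c * u\<^sup>2)" using ee by (simp add: mult_ac)
    finally have "\<bar>u * poly q u\<bar> \<le> (1 + 2 / c) * B * exp (c * u\<^sup>2)" by (simp add: abs_mult)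
    moreover have "\<bar>a\<bar> \<le> \<bar>a\<bar> * exp (c * u\<^sup>2)"
      using mult_left_mono[OF e1, of "\<bar>a\<bar>"] by simp
    moreover have "\<bar>poly (pCons a q) u\<bar> \<le> \<bar>a\<bar> + \<bar>u * poly q u\<bar>" by simp
    ultimately show ?thesis unfolding distrib_right by linarith
  qed
  then show ?case by blast
qed

lemma gauss_deriv_bounded: "\<exists>B. \<forall>x s. \<bar>gauss_deriv k x s\<bar> \<le> B"
proof -
  obtain B where B: "\<And>u. \<bar>poly (exp_square_poly (- 1) k) u\<bar> \<le> B * exp (1 * u\<^sup>2)"
    using poly_le_exp_square[of 1] by fastforce
  have "\<bar>gauss_deriv k x s\<bar> \<le> B" for x s
  proof -
    have "\<bar>gauss_deriv k x s\<bar> \<le> B * exp (1 * (x - s)\<^sup>2) * exp (- (x - s)\<^sup>2)"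
      unfolding gauss_deriv_def abs_mult abs_exp_cancel by (intro mult_right_mono B) simp
    then show ?thesis by (simp add: mult.assoc exp_add[symmetric])
  qed
  then show ?thesis by blast
qed

lemma gauss_deriv_lipschitz:
  "\<exists>B. \<forall>x y s. \<bar>gauss_deriv k y s - gauss_deriv k x s\<bar> \<le> B * \<bar>y - x\<bar>"
proof -
  obtain B where B: "\<And>x s. \<bar>gauss_deriv (Suc k) x s\<bar> \<le> B"
    using gauss_deriv_bounded by blast
  have "norm (gauss_deriv k y s - gauss_deriv k x s) \<le> B * norm (y - x)" for x y s
    by (rule field_differentiable_bound[where S = UNIV and f' = "\<lambda>x. gauss_deriv (Suc k) x s"])
       (simp_all add: DERIV_gauss_deriv B)
  then show ?thesis by auto
qed

text \<open>Uniformity in s lets the estimate survive integration against a finite measure: it gives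
  both the L2 derivatives of the kernel and differentiation under the integral.\<close>

lemma gauss_deriv_taylor:
  "\<exists>B. \<forall>x y s. \<bar>gauss_deriv k y s - gauss_deriv k x s - (y - x) * gauss_deriv (Suc k) x s\<bar>
     \<le> B * (y - x)\<^sup>2"
proof -
  obtain B where B: "\<And>x y s. \<bar>gauss_deriv (Suc k) y s - gauss_deriv (Suc k) x s\<bar> \<le> B * \<bar>y - x\<bar>"
    using gauss_deriv_lipschitz by blast
  have B0: "0 \<le> B" using B[of 1 0 0] by auto
  have "\<bar>gauss_deriv k y s - gauss_deriv k x s - (y - x) * gauss_deriv (Suc k) x s\<bar> \<le> B * (y - x)\<^sup>2"
    for x y s
  proof -
    let ?g = "\<lambda>z. gauss_deriv k z s - gauss_deriv (Suc k) x s * z"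
    have "norm (?g y - ?g x) \<le> (B * \<bar>y - x\<bar>) * norm (y - x)"
    proof (rule field_differentiable_bound[where S = "closed_segment x y"
          and f' = "\<lambda>z. gauss_deriv (Suc k) z s - gauss_deriv (Suc k) x s"])
      fix z assume z: "z \<in> closed_segment x y"
      show "(?g has_field_derivative gauss_deriv (Suc k) z s - gauss_deriv (Suc k) x s)
          (at z within closed_segment x y)"
        by (intro DERIV_diff DERIV_gauss_deriv DERIV_cmult_Id)
      have "\<bar>z - x\<bar> \<le> \<bar>y - x\<bar>" using z by (auto simp: closed_segment_eq_real_ivl split: if_splits)
      then have "B * \<bar>z - x\<bar> \<le> B * \<bar>y - x\<bar>" using B0 by (intro mult_left_mono)
      then show "norm (gauss_deriv (Suc k) z s - gauss_deriv (Suc k) x s) \<le> B * \<bar>y - x\<bar>"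
        using B[of z s x] by simp
    qed auto
    then show ?thesis by (simp add: power2_eq_square algebra_simps abs_mult[symmetric])
  qed
  then show ?thesis by blast
qed

section \<open>Derivatives in the L2 norm\<close>

lemma bounded_in_L2_space:
  assumes "finite_measure P" "f \<in> borel_measurable P" "\<And>s. \<bar>f s\<bar> \<le> B"
  shows "f \<in> L2_space P" "L2_norm P f \<le> B * sqrt (measure P (space P))"
proof -
  interpret finite_measure P by fact
  have sq: "(f s)\<^sup>2 \<le> B\<^sup>2" for s using assms(3)[of s] by (metis abs_le_square_iff abs_of_nonneg abs_ge_zero order_trans)
  have int: "integrable P (\<lambda>s. (f s)\<^sup>2)"
    using assms(2) sq by (intro integrable_const_bound[of _ "B\<^sup>2"]) auto
  then show "f \<in> L2_space P" using assms(2) by (simp add: L2_space_def)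
  have B: "0 \<le> B" using assms(3)[of 0] by simp
  have "(LINT s|P. (f s)\<^sup>2) \<le> (LINT s|P. B\<^sup>2)"
    using int sq by (intro integral_mono) auto
  then have "L2_norm P f \<le> sqrt (B\<^sup>2 * measure P (space P))"
    unfolding L2_norm_def L2_inner_def
    by (intro real_sqrt_le_mono) (simp add: power2_eq_square mult.commute)
  then show "L2_norm P f \<le> B * sqrt (measure P (space P))"
    using B by (simp add: real_sqrt_mult)
qed

lemma gauss_deriv_borel_measurable:
  assumes "sets P = sets borel"
  shows "gauss_deriv k x \<in> borel_measurable P"
  unfolding measurable_cong_sets[OF assms refl]
  by (rule borel_measurable_continuous_onI[OF continuous_gauss_deriv])

lemma gauss_deriv_in_L2_space:
  assumes "finite_measure P" "sets P = sets borel"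
  shows "gauss_deriv k x \<in> L2_space P"
proof -
  obtain B where "\<And>x s. \<bar>gauss_deriv k x s\<bar> \<le> B" using gauss_deriv_bounded by blast
  then show ?thesis
    using bounded_in_L2_space(1)[OF assms(1) gauss_deriv_borel_measurable[OF assms(2)]] by blast
qed

lemma L2_norm_cong_AE:
  assumes "f \<in> borel_measurable P" "g \<in> borel_measurable P" "AE s in P. f s = g s"
  shows "L2_norm P f = L2_norm P g"
  unfolding L2_norm_def L2_inner_def using assms
  by (intro arg_cong[of _ _ sqrt] integral_cong_AE) auto

text \<open>With the difference quotient q, the pointwise bound $(D-D')^2 \<le> 2(q-D)^2 +
  2(q-D')^2$ takes the place of a triangle inequality for the norm.\<close>

lemma has_L2_derivative_unique:
  assumes D: "has_L2_derivative P X f x D" and D': "has_L2_derivative P X f x D'"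
    and f: "\<And>y. y \<in> X \<Longrightarrow> f y \<in> L2_space P" and x: "x \<in> X" "x islimpt X"
  shows "AE s in P. D s = D' s"
proof -
  define q where "q = (\<lambda>y s. (f y s - f x s) / (y - x))"
  have DL: "D \<in> L2_space P" "D' \<in> L2_space P"
    using D D' by (auto simp: has_L2_derivative_def)
  have lim: "((\<lambda>y. 2 * (L2_norm P (\<lambda>s. q y s - D s))\<^sup>2 + 2 * (L2_norm P (\<lambda>s. q y s - D' s))\<^sup>2)
      \<longlongrightarrow> 2 * 0\<^sup>2 + 2 * 0\<^sup>2) (at x within X)"
    using D D' unfolding has_L2_derivative_def q_def by (intro tendsto_intros) auto
  have le: "L2_inner P (\<lambda>s. D s - D' s) (\<lambda>s. D s - D' s)
      \<le> 2 * (L2_norm P (\<lambda>s. q y s - D s))\<^sup>2 + 2 * (L2_norm P (\<lambda>s. q y s - D' s))\<^sup>2"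
    if y: "y \<in> X" for y
  proof -
    have qL: "q y \<in> L2_space P"
      unfolding q_def using L2_space_cmult[OF L2_space_diff[OF f[OF y] f[OF x(1)]], of "1 / (y - x)"]
      by simp
    have i: "integrable P (\<lambda>s. (h s)\<^sup>2)" if "h \<in> L2_space P" for h
      using L2_space_D[OF that] by simp
    note i1 = i[OF L2_space_diff[OF qL DL(1)]] and i2 = i[OF L2_space_diff[OF qL DL(2)]]
      and i3 = i[OF L2_space_diff[OF DL]]
    have "L2_inner P (\<lambda>s. D s - D' s) (\<lambda>s. D s - D' s) = (LINT s|P. (D s - D' s)\<^sup>2)"
      by (simp add: L2_inner_def power2_eq_square)
    also have "\<dots> \<le> (LINT s|P. 2 * (q y s - D s)\<^sup>2 + 2 * (q y s - D' s)\<^sup>2)"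
    proof (rule integral_mono)
      fix s
      have "(D s - D' s)\<^sup>2 + ((q y s - D s) + (q y s - D' s))\<^sup>2
          = 2 * (q y s - D s)\<^sup>2 + 2 * (q y s - D' s)\<^sup>2"
        by (simp add: power2_eq_square algebra_simps)
      then show "(D s - D' s)\<^sup>2 \<le> 2 * (q y s - D s)\<^sup>2 + 2 * (q y s - D' s)\<^sup>2"
        using zero_le_power2[of "(q y s - D s) + (q y s - D' s)"] by linarith
    qed (use i1 i2 i3 in auto)
    also have "\<dots> = 2 * (LINT s|P. (q y s - D s)\<^sup>2) + 2 * (LINT s|P. (q y s - D' s)\<^sup>2)"
      using i1 i2 by simp
    also have "\<dots> = 2 * (L2_norm P (\<lambda>s. q y s - D s))\<^sup>2 + 2 * (L2_norm P (\<lambda>s. q y s - D' s))\<^sup>2"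
      unfolding L2_norm_def by (simp add: L2_inner_self_nonneg) (simp add: L2_inner_def power2_eq_square)
    finally show ?thesis .
  qed
  have "L2_inner P (\<lambda>s. D s - D' s) (\<lambda>s. D s - D' s) \<le> 2 * 0\<^sup>2 + 2 * 0\<^sup>2"
  proof (rule tendsto_lowerbound[OF lim])
    show "\<forall>\<^sub>F y in at x within X. L2_inner P (\<lambda>s. D s - D' s) (\<lambda>s. D s - D' s)
        \<le> 2 * (L2_norm P (\<lambda>s. q y s - D s))\<^sup>2 + 2 * (L2_norm P (\<lambda>s. q y s - D' s))\<^sup>2"
      using le unfolding eventually_at_topological by blast
    show "at x within X \<noteq> bot" using x by (simp add: trivial_limit_within)
  qed
  then have "L2_inner P (\<lambda>s. D s - D' s) (\<lambda>s. D s - D' s) = 0"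
    using L2_inner_self_nonneg[of P "\<lambda>s. D s - D' s"] by simp
  then have "AE s in P. D s - D' s = 0"
    using L2_inner_self_eq_0_iff[OF L2_space_diff[OF DL]] by simp
  then show ?thesis by simp
qed

lemma has_L2_derivative_cong_AE:
  assumes D: "has_L2_derivative P X f x D" and x: "x \<in> X"
    and f: "\<And>y. y \<in> X \<Longrightarrow> f y \<in> L2_space P" and g: "\<And>y. y \<in> X \<Longrightarrow> g y \<in> L2_space P"
    and eq: "\<And>y. y \<in> X \<Longrightarrow> AE s in P. f y s = g y s"
  shows "has_L2_derivative P X g x D"
proof -
  have DL: "D \<in> L2_space P" using D by (simp add: has_L2_derivative_def)
  have norm_eq: "L2_norm P (\<lambda>s. (f y s - f x s) / (y - x) - D s)
      = L2_norm P (\<lambda>s. (g y s - g x s) / (y - x) - D s)" if y: "y \<in> X" for y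
  proof (rule L2_norm_cong_AE)
    have [measurable]: "f y \<in> borel_measurable P" "f x \<in> borel_measurable P" "D \<in> borel_measurable P"
      "g y \<in> borel_measurable P" "g x \<in> borel_measurable P"
      using f g x y DL by (auto dest: L2_space_D)
    show "(\<lambda>s. (f y s - f x s) / (y - x) - D s) \<in> borel_measurable P" by measurable
    show "(\<lambda>s. (g y s - g x s) / (y - x) - D s) \<in> borel_measurable P" by measurable
    show "AE s in P. (f y s - f x s) / (y - x) - D s = (g y s - g x s) / (y - x) - D s"
      using eq[OF y] eq[OF x] by eventually_elim simp
  qed
  have "((\<lambda>y. L2_norm P (\<lambda>s. (f y s - f x s) / (y - x) - D s)) \<longlongrightarrow> 0) (at x within X)"
    using D by (simp add: has_L2_derivative_def)
  then have "((\<lambda>y. L2_norm P (\<lambda>s. (g y s - g x s) / (y - x) - D s)) \<longlongrightarrow> 0) (at x within X)"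
    by (rule Lim_transform_eventually) (use norm_eq in \<open>auto simp: eventually_at_topological\<close>)
  then show ?thesis using DL by (simp add: has_L2_derivative_def)
qed

lemma L2_norm_nonneg: "0 \<le> L2_norm P f"
  by (simp add: L2_norm_def L2_inner_self_nonneg)

lemma has_L2_derivative_gauss_deriv:
  assumes P: "finite_measure P" "sets P = sets borel"
  shows "has_L2_derivative P X (gauss_deriv k) x (gauss_deriv (Suc k) x)"
proof -
  obtain B where B: "\<And>x y s. \<bar>gauss_deriv k y s - gauss_deriv k x s - (y - x) * gauss_deriv (Suc k) x s\<bar>
     \<le> B * (y - x)\<^sup>2"
    using gauss_deriv_taylor by blast
  have B0: "0 \<le> B" using B[of 1 0 0] by auto
  let ?m = "sqrt (measure P (space P))"
  have bound: "L2_norm P (\<lambda>s. (gauss_deriv k y s - gauss_deriv k x s) / (y - x) - gauss_deriv (Suc k) x s)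
      \<le> (B * \<bar>y - x\<bar>) * ?m" if "y \<noteq> x" for y
  proof (rule bounded_in_L2_space(2)[OF P(1)])
    have [measurable]: "gauss_deriv i z \<in> borel_measurable P" for i z
      by (rule gauss_deriv_borel_measurable[OF P(2)])
    show "(\<lambda>s. (gauss_deriv k y s - gauss_deriv k x s) / (y - x) - gauss_deriv (Suc k) x s)
        \<in> borel_measurable P" by measurable
    fix s
    have "(gauss_deriv k y s - gauss_deriv k x s) / (y - x) - gauss_deriv (Suc k) x s
        = (gauss_deriv k y s - gauss_deriv k x s - (y - x) * gauss_deriv (Suc k) x s) / (y - x)"
      using that by (simp add: diff_divide_distrib)
    then have "\<bar>(gauss_deriv k y s - gauss_deriv k x s) / (y - x) - gauss_deriv (Suc k) x s\<bar>
        \<le> B * (y - x)\<^sup>2 / \<bar>y - x\<bar>"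
      using B[of y s x] by (simp add: divide_right_mono)
    also have "\<dots> = B * \<bar>y - x\<bar>"
      using that by (simp add: power2_eq_square abs_mult[symmetric] field_simps abs_if)
    finally show "\<bar>(gauss_deriv k y s - gauss_deriv k x s) / (y - x) - gauss_deriv (Suc k) x s\<bar>
        \<le> B * \<bar>y - x\<bar>" .
  qed
  have "((\<lambda>y. B * \<bar>y - x\<bar> * ?m) \<longlongrightarrow> B * \<bar>x - x\<bar> * ?m) (at x within X)"
    by (intro tendsto_intros)
  then have "((\<lambda>y. B * \<bar>y - x\<bar> * ?m) \<longlongrightarrow> 0) (at x within X)" by simp
  then have "((\<lambda>y. L2_norm P (\<lambda>s. (gauss_deriv k y s - gauss_deriv k x s) / (y - x)
      - gauss_deriv (Suc k) x s)) \<longlongrightarrow> 0) (at x within X)"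
  proof (rule Lim_null_comparison[rotated])
    show "\<forall>\<^sub>F y in at x within X. norm (L2_norm P (\<lambda>s. (gauss_deriv k y s - gauss_deriv k x s) / (y - x)
        - gauss_deriv (Suc k) x s)) \<le> B * \<bar>y - x\<bar> * ?m"
      unfolding eventually_at_topological
      by (intro exI[of _ UNIV]) (simp add: bound L2_norm_nonneg)
  qed
  then show ?thesis
    using gauss_deriv_in_L2_space[OF P] by (simp add: has_L2_derivative_def)
qed

text \<open>Every iterate is an arbitrary choice, so the induction carries equality almost
  everywhere with \<open>gauss_deriv\<close>. It is crossed twice: once to see that a derivative
  exists, once to identify the chosen one by uniqueness.\<close>

lemma L2_higher_deriv_gaussian:
  assumes P: "finite_measure P" "sets P = sets borel" and X: "\<forall>x\<in>X. x islimpt X"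
    and "x \<in> X"
  shows "L2_higher_deriv P X k gaussian_kernel x \<in> L2_space P"
    "AE s in P. L2_higher_deriv P X k gaussian_kernel x s = gauss_deriv k x s"
    "has_L2_derivative P X (L2_higher_deriv P X k gaussian_kernel) x
       (L2_higher_deriv P X (Suc k) gaussian_kernel x)"
proof -
  let ?D = "\<lambda>k. L2_higher_deriv P X k gaussian_kernel"
  note G = gauss_deriv_in_L2_space[OF P]
  have der: "has_L2_derivative P X (?D k) x (?D (Suc k) x)"
    if "\<forall>x\<in>X. ?D k x \<in> L2_space P \<and> (AE s in P. ?D k x s = gauss_deriv k x s)" "x \<in> X" for k x
  proof -
    have "has_L2_derivative P X (?D k) x (gauss_deriv (Suc k) x)"
    proof (rule has_L2_derivative_cong_AE[OF has_L2_derivative_gauss_deriv[OF P] that(2) G])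
      fix y assume "y \<in> X"
      then have "AE s in P. ?D k y s = gauss_deriv k y s" "?D k y \<in> L2_space P"
        using that(1) by blast+
      then show "AE s in P. gauss_deriv k y s = ?D k y s" "?D k y \<in> L2_space P"
        by (auto elim!: eventually_mono)
    qed
    then show ?thesis
      unfolding funpow.simps o_apply L2_deriv_def[of P X "?D k"]
      by (rule someI[of "has_L2_derivative P X (?D k) x"])
  qed
  have main: "\<forall>x\<in>X. ?D k x \<in> L2_space P \<and> (AE s in P. ?D k x s = gauss_deriv k x s)" for k
  proof (induction k)
    case 0
    then show ?case using G[of 0] by (simp add: gauss_deriv_0)
  next
    case (Suc k)
    show ?case
    proof
      fix x assume x: "x \<in> X"
      note d = der[OF Suc x]
      have "has_L2_derivative P X (gauss_deriv k) x (?D (Suc k) x)"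
        by (rule has_L2_derivative_cong_AE[OF d x]) (use Suc G in blast)+
      then have "AE s in P. ?D (Suc k) x s = gauss_deriv (Suc k) x s"
        by (rule has_L2_derivative_unique[OF _ has_L2_derivative_gauss_deriv[OF P] G x bspec[OF X x]])
      then show "?D (Suc k) x \<in> L2_space P \<and> (AE s in P. ?D (Suc k) x s = gauss_deriv (Suc k) x s)"
        using d unfolding has_L2_derivative_def by blast
    qed
  qed
  show "?D k x \<in> L2_space P" "AE s in P. ?D k x s = gauss_deriv k x s"
    using main \<open>x \<in> X\<close> by blast+
  show "has_L2_derivative P X (?D k) x (?D (Suc k) x)"
    by (rule der[OF main \<open>x \<in> X\<close>])
qed

text \<open>Smoothness and bounds hold at every order; the decay condition does not mention the
  order and is inherited from k.\<close>

lemma gaussian_in_kernel_class: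
  assumes P: "finite_measure P" "sets P = sets borel" and X: "\<forall>x\<in>X. x islimpt X"
    and "gaussian_kernel \<in> kernel_class k P X"
  shows "gaussian_kernel \<in> kernel_class n P X"
proof -
  let ?D = "\<lambda>k. L2_higher_deriv P X k gaussian_kernel"
  let ?m = "sqrt (measure P (space P))"
  note hd = L2_higher_deriv_gaussian[OF P X]
  have [measurable]: "gauss_deriv i z \<in> borel_measurable P" for i z
    by (rule gauss_deriv_borel_measurable[OF P(2)])
  have D[measurable]: "?D i x \<in> borel_measurable P" if "x \<in> X" for i x
    using L2_space_D[OF hd(1)[OF that]] by blast
  have "L2_continuous_on P X (?D n)"
    unfolding L2_continuous_on_def
  proof
    fix x assume x: "x \<in> X"
    obtain B where B: "\<And>x y s. \<bar>gauss_deriv n y s - gauss_deriv n x s\<bar> \<le> B * \<bar>y - x\<bar>"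
      using gauss_deriv_lipschitz by blast
    have le: "L2_norm P (\<lambda>s. ?D n y s - ?D n x s) \<le> B * \<bar>y - x\<bar> * ?m" if y: "y \<in> X" for y
    proof -
      have "L2_norm P (\<lambda>s. ?D n y s - ?D n x s) = L2_norm P (\<lambda>s. gauss_deriv n y s - gauss_deriv n x s)"
      proof (rule L2_norm_cong_AE)
        show "AE s in P. ?D n y s - ?D n x s = gauss_deriv n y s - gauss_deriv n x s"
          using hd(2)[OF x, of n] hd(2)[OF y, of n] by eventually_elim simp
      qed (use D[OF x] D[OF y] in measurable)
      also have "\<dots> \<le> B * \<bar>y - x\<bar> * ?m"
        by (rule bounded_in_L2_space(2)[OF P(1) _ B]) measurable
      finally show ?thesis .
    qed
    have ev: "\<forall>\<^sub>F y in at x within X. norm (L2_norm P (\<lambda>s. ?D n y s - ?D n x s)) \<le> B * \<bar>y - x\<bar> * ?m"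
      unfolding eventually_at_topological
      by (intro exI[of _ UNIV]) (simp add: le L2_norm_nonneg)
    have "((\<lambda>y. B * \<bar>y - x\<bar> * ?m) \<longlongrightarrow> B * \<bar>x - x\<bar> * ?m) (at x within X)"
      by (intro tendsto_intros)
    then have "((\<lambda>y. B * \<bar>y - x\<bar> * ?m) \<longlongrightarrow> 0) (at x within X)" by simp
    with ev show "((\<lambda>y. L2_norm P (\<lambda>s. ?D n y s - ?D n x s)) \<longlongrightarrow> 0) (at x within X)"
      by (rule Lim_null_comparison)
  qed
  moreover have "\<exists>B. \<forall>x\<in>X. L2_norm P (?D i x) \<le> B" for i
  proof -
    obtain B where B: "\<And>x s. \<bar>gauss_deriv i x s\<bar> \<le> B" using gauss_deriv_bounded by blast
    have "L2_norm P (?D i x) \<le> B * ?m" if x: "x \<in> X" for x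
    proof -
      have "L2_norm P (?D i x) = L2_norm P (gauss_deriv i x)"
        by (rule L2_norm_cong_AE[OF D[OF x] _ hd(2)[OF x]]) measurable
      also have "\<dots> \<le> B * ?m"
        by (rule bounded_in_L2_space(2)[OF P(1) _ B]) measurable
      finally show ?thesis .
    qed
    then show ?thesis by blast
  qed
  moreover have "\<forall>p\<in>L2_space P. (\<lambda>x. L2_inner P p (gaussian_kernel x)) \<in> C_zero X"
    using assms(4) unfolding kernel_class_def by blast
  ultimately show ?thesis
    unfolding kernel_class_def L2_C_def
    by (intro CollectI conjI allI impI ballI) (assumption | rule hd(1) hd(3) | blast)+
qed

section \<open>The certificate and its defect\<close>

lemma DERIV_if_quadratic_error:
  fixes f :: "real \<Rightarrow> real"
  assumes "\<And>y. \<bar>f y - f x - (y - x) * D\<bar> \<le> C * (y - x)\<^sup>2"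
  shows "(f has_real_derivative D) (at x)"
proof -
  have "((\<lambda>y. (f y - f x) / (y - x) - D) \<longlongrightarrow> 0) (at x)"
  proof (rule Lim_null_comparison)
    show "\<forall>\<^sub>F y in at x. norm ((f y - f x) / (y - x) - D) \<le> C * \<bar>y - x\<bar>"
      unfolding eventually_at_topological
    proof (intro exI[of _ UNIV] conjI ballI impI)
      fix y assume "y \<noteq> x"
      then have "(f y - f x) / (y - x) - D = (f y - f x - (y - x) * D) / (y - x)"
        by (simp add: diff_divide_distrib)
      then have "\<bar>(f y - f x) / (y - x) - D\<bar> \<le> C * (y - x)\<^sup>2 / \<bar>y - x\<bar>"
        using assms[of y] by (simp add: divide_right_mono)
      also have "\<dots> = C * \<bar>y - x\<bar>"
        using \<open>y \<noteq> x\<close> by (simp add: power2_eq_square abs_mult[symmetric] field_simps abs_if)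
      finally show "norm ((f y - f x) / (y - x) - D) \<le> C * \<bar>y - x\<bar>" by simp
    qed auto
    have "((\<lambda>y. C * \<bar>y - x\<bar>) \<longlongrightarrow> C * \<bar>x - x\<bar>) (at x)" by (intro tendsto_intros)
    then show "((\<lambda>y. C * \<bar>y - x\<bar>) \<longlongrightarrow> 0) (at x)" by simp
  qed
  then show ?thesis unfolding has_field_derivative_iff by (simp add: LIM_zero_iff)
qed

text \<open>The Taylor error is uniform in s and gets multiplied by p, which is integrable because
  constants are square-integrable for a finite measure.\<close>

lemma deriv_seq_certificate:
  assumes P: "finite_measure P" "sets P = sets borel" and p: "p \<in> L2_space P"
  shows "deriv_seq (\<lambda>x k. L2_inner P (gauss_deriv k x) p)"
  unfolding deriv_seq_def
proof (intro allI)
  fix x k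
  obtain B where B: "\<And>x y s. \<bar>gauss_deriv k y s - gauss_deriv k x s - (y - x) * gauss_deriv (Suc k) x s\<bar>
     \<le> B * (y - x)\<^sup>2"
    using gauss_deriv_taylor by blast
  have one: "(\<lambda>s. 1) \<in> L2_space P"
    by (rule bounded_in_L2_space(1)[OF P(1), of _ 1]) auto
  have ip: "integrable P (\<lambda>s. \<bar>p s\<bar>)"
    using L2_space_integrable_mult[OF one p] by simp
  have ig: "integrable P (\<lambda>s. gauss_deriv i z s * p s)" for i z
    by (rule L2_space_integrable_mult[OF gauss_deriv_in_L2_space[OF P] p])
  show "((\<lambda>x. L2_inner P (gauss_deriv k x) p) has_real_derivative L2_inner P (gauss_deriv (Suc k) x) p) (at x)"
  proof (rule DERIV_if_quadratic_error)
    fix y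
    let ?h = "\<lambda>s. gauss_deriv k y s - gauss_deriv k x s - (y - x) * gauss_deriv (Suc k) x s"
    have hp: "?h s * p s = gauss_deriv k y s * p s - gauss_deriv k x s * p s
        - (y - x) * (gauss_deriv (Suc k) x s * p s)" for s
      by (simp add: algebra_simps)
    have int: "integrable P (\<lambda>s. ?h s * p s)"
      unfolding hp using ig by (intro Bochner_Integration.integrable_diff integrable_mult_right)
    have "L2_inner P (gauss_deriv k y) p - L2_inner P (gauss_deriv k x) p
        - (y - x) * L2_inner P (gauss_deriv (Suc k) x) p = (LINT s|P. ?h s * p s)"
      unfolding hp L2_inner_def using ig by simp
    moreover have "\<bar>LINT s|P. ?h s * p s\<bar> \<le> (LINT s|P. B * (y - x)\<^sup>2 * \<bar>p s\<bar>)"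
    proof (rule order.trans[OF integral_abs_bound], rule integral_mono)
      show "\<bar>?h s * p s\<bar> \<le> B * (y - x)\<^sup>2 * \<bar>p s\<bar>" for s
        unfolding abs_mult[of "?h s"] by (intro mult_right_mono B) simp
    qed (use int ip in auto)
    moreover have "(LINT s|P. B * (y - x)\<^sup>2 * \<bar>p s\<bar>) = (B * (LINT s|P. \<bar>p s\<bar>)) * (y - x)\<^sup>2"
      by (simp add: mult_ac)
    ultimately show "\<bar>L2_inner P (gauss_deriv k y) p - L2_inner P (gauss_deriv k x) p
        - (y - x) * L2_inner P (gauss_deriv (Suc k) x) p\<bar> \<le> (B * (LINT s|P. \<bar>p s\<bar>)) * (y - x)\<^sup>2"
      by linarith
  qed
qed

lemma deriv_seq_funpow:
  assumes "deriv_seq G"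
  shows "(deriv ^^ k) (\<lambda>y. G y 0) = (\<lambda>y. G y k)"
proof (induction k)
  case (Suc k)
  then show ?case
    using assms by (auto simp: deriv_seq_def intro!: ext DERIV_imp_deriv)
qed simp

lemma deriv_seq_unique:
  assumes "deriv_seq G" "deriv_seq H" "\<And>y. G y 0 = H y 0"
  shows "G y k = H y k"
proof -
  have "(\<lambda>y. G y 0) = (\<lambda>y. H y 0)" using assms(3) by (rule ext)
  then have "(\<lambda>y. G y k) = (\<lambda>y. H y k)"
    using deriv_seq_funpow[OF assms(1), of k] deriv_seq_funpow[OF assms(2), of k] by simp
  then show ?thesis by (rule fun_cong)
qed

lemma higher_deriv_certificate:
  assumes "finite_measure P" "sets P = sets borel" "p \<in> L2_space P"
  shows "(deriv ^^ k) (Phi_adj P gaussian_kernel p) = (\<lambda>x. L2_inner P (gauss_deriv k x) p)"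
  using deriv_seq_funpow[OF deriv_seq_certificate[OF assms], of k]
  by (simp add: Phi_adj_def gauss_deriv_0)

section \<open>The product rule on derivative sequences\<close>

text \<open>The n-th derivative of a product in terms of the derivatives of its factors. Recursion
  by the product rule avoids binomial coefficients and makes linearity an easy induction.\<close>

fun leibniz :: "nat \<Rightarrow> (nat \<Rightarrow> real) \<Rightarrow> (nat \<Rightarrow> real) \<Rightarrow> real" where
  "leibniz 0 e u = e 0 * u 0"
| "leibniz (Suc n) e u = leibniz n (\<lambda>i. e (Suc i)) u + leibniz n e (\<lambda>i. u (Suc i))"

lemma deriv_seq_leibniz:
  assumes "deriv_seq E" "deriv_seq U"
  shows "deriv_seq (\<lambda>y n. leibniz n (E y) (U y))"
  unfolding deriv_seq_def
proof (intro allI)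
  fix y n
  show "((\<lambda>y. leibniz n (E y) (U y)) has_real_derivative leibniz (Suc n) (E y) (U y)) (at y)"
    using assms
  proof (induction n arbitrary: E U)
    case 0
    have "((\<lambda>y. E y 0) has_real_derivative E y 1) (at y)" "((\<lambda>y. U y 0) has_real_derivative U y 1) (at y)"
      using 0 by (auto simp: deriv_seq_def)
    from DERIV_mult[OF this] show ?case by (simp add: algebra_simps)
  next
    case (Suc n)
    have "deriv_seq (\<lambda>y i. E y (Suc i))" "deriv_seq (\<lambda>y i. U y (Suc i))"
      using Suc.prems by (auto simp: deriv_seq_def)
    from DERIV_add[OF Suc.IH[OF this(1) Suc.prems(2)] Suc.IH[OF Suc.prems(1) this(2)]]
    show ?case by simp
  qed
qed

lemma leibniz_vanishing:
  assumes "\<And>i. i < n \<Longrightarrow> u i = 0"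
  shows "leibniz n e u = e 0 * u n"
  using assms
proof (induction n arbitrary: e u)
  case (Suc n)
  then show ?case using Suc.IH[of u "\<lambda>i. e (Suc i)"] Suc.IH[of "\<lambda>i. u (Suc i)" e] by simp
qed simp

lemma leibniz_const: "leibniz n e (\<lambda>i. if i = 0 then 1 else 0) = e n"
proof (induction n arbitrary: e)
  case (Suc n)
  have "leibniz n e (\<lambda>i. 0) = 0" by (subst leibniz_vanishing) auto
  then show ?case using Suc.IH by simp
qed simp

lemma leibniz_diff: "leibniz n e (\<lambda>i. u i - v i) = leibniz n e u - leibniz n e v"
  by (induction n arbitrary: e u v) (simp_all add: algebra_simps)

lemma leibniz_cmult: "leibniz n e (\<lambda>i. u i * c) = leibniz n e u * c"
  by (induction n arbitrary: e u) (simp_all add: algebra_simps)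

lemma leibniz_integral:
  assumes "\<And>i. integrable P (\<lambda>s. v s i)"
  shows "integrable P (\<lambda>s. leibniz n e (v s))
    \<and> leibniz n e (\<lambda>i. LINT s|P. v s i) = (LINT s|P. leibniz n e (v s))"
  using assms
proof (induction n arbitrary: e v)
  case (Suc n)
  show ?case
    using Suc.IH[of v "\<lambda>i. e (Suc i)", OF Suc.prems] Suc.IH[of "\<lambda>s i. v s (Suc i)" e, OF Suc.prems]
    by simp
qed simp

lemma fold_dop_diff: "fold dop ts (\<lambda>i. a i - b i) 0 = fold dop ts a 0 - fold dop ts b 0"
proof (induction ts arbitrary: a b)
  case (Cons t ts)
  have "dop t (\<lambda>i. a i - b i) = (\<lambda>i. dop t a i - dop t b i)"
    by (auto simp: dop_def algebra_simps)
  then show ?case using Cons.IH by simp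
qed simp

lemma fold_dop_integral:
  assumes "\<And>i. integrable P (\<lambda>s. v s i)"
  shows "integrable P (\<lambda>s. fold dop ts (v s) 0)
    \<and> fold dop ts (\<lambda>i. LINT s|P. v s i) 0 = (LINT s|P. fold dop ts (v s) 0)"
  using assms
proof (induction ts arbitrary: v)
  case (Cons t ts)
  have "integrable P (\<lambda>s. dop t (v s) i)" for i
    unfolding dop_def using Cons.prems by simp
  from Cons.IH[OF this]
  have "integrable P (\<lambda>s. fold dop ts (dop t (v s)) 0)
    \<and> fold dop ts (\<lambda>i. LINT s|P. dop t (v s) i) 0 = (LINT s|P. fold dop ts (dop t (v s)) 0)" .
  moreover have "(\<lambda>i. LINT s|P. dop t (v s) i) = dop t (\<lambda>i. LINT s|P. v s i)"
    unfolding dop_def using Cons.prems by auto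
  ultimately show ?case by simp
qed simp

text \<open>$c^n k$ lists the derivatives of $k e^{cz}$ at 0, an eigenfunction of D - t with
  eigenvalue c - t.\<close>

lemma fold_dop_power: "fold dop ts (\<lambda>n. c ^ n * k) 0 = (\<Prod>t\<leftarrow>ts. c - t) * k"
proof (induction ts arbitrary: k)
  case (Cons t ts)
  have "dop t (\<lambda>n. c ^ n * k) = (\<lambda>n. c ^ n * ((c - t) * k))"
    by (auto simp: dop_def algebra_simps)
  then show ?case using Cons.IH by simp
qed simp

definition exp_square_seq :: "real \<Rightarrow> real \<Rightarrow> nat \<Rightarrow> real" where
  "exp_square_seq c y n = poly (exp_square_poly 1 n) (y - c) * exp ((y - c)\<^sup>2)"

lemma deriv_seq_exp_square_seq: "deriv_seq (exp_square_seq c)"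
  unfolding deriv_seq_def
proof (intro allI)
  fix y i
  have "((\<lambda>z. poly (exp_square_poly 1 i) z * exp (1 * z\<^sup>2)) has_real_derivative
      poly (exp_square_poly 1 (Suc i)) (y + - c) * exp (1 * (y + - c)\<^sup>2)) (at (y + - c))"
    using deriv_seq_exp_square[of 1] unfolding deriv_seq_def by blast
  then show "((\<lambda>y. exp_square_seq c y i) has_real_derivative exp_square_seq c y (Suc i)) (at y)"
    unfolding DERIV_shift exp_square_seq_def by (simp del: exp_square_poly.simps)
qed

text \<open>The exponent $(y-c)^2 - (y-s)^2 = 2(s-c)(y-c) - (s-c)^2$ is linear in y. Both sides are
  derivative sequences with equal entries at 0, hence equal throughout.\<close>

lemma leibniz_exp_square_gauss:
  "leibniz n (exp_square_seq c y) (\<lambda>k. gauss_deriv k y s)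
    = (2 * (s - c)) ^ n * exp (2 * (s - c) * (y - c) - (s - c)\<^sup>2)"
proof (rule deriv_seq_unique[of "\<lambda>y n. leibniz n (exp_square_seq c y) (\<lambda>k. gauss_deriv k y s)"
      "\<lambda>y n. (2 * (s - c)) ^ n * exp (2 * (s - c) * (y - c) - (s - c)\<^sup>2)"])
  show "deriv_seq (\<lambda>y n. leibniz n (exp_square_seq c y) (\<lambda>k. gauss_deriv k y s))"
    by (rule deriv_seq_leibniz[OF deriv_seq_exp_square_seq deriv_seq_gauss])
  show "deriv_seq (\<lambda>y n. (2 * (s - c)) ^ n * exp (2 * (s - c) * (y - c) - (s - c)\<^sup>2))"
    unfolding deriv_seq_def by (auto intro!: derivative_eq_intros)
  show "leibniz 0 (exp_square_seq c y) (\<lambda>k. gauss_deriv k y s)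
      = (2 * (s - c)) ^ 0 * exp (2 * (s - c) * (y - c) - (s - c)\<^sup>2)" for y
    by (simp add: exp_square_seq_def gauss_deriv_def exp_add[symmetric])
       (simp add: power2_eq_square algebra_simps)
qed

text \<open>The derivatives of 1 minus the certificate; the conditional lists those of the constant
  1.\<close>

definition defect_seq :: "real measure \<Rightarrow> (real \<Rightarrow> real) \<Rightarrow> real \<Rightarrow> nat \<Rightarrow> real" where
  "defect_seq P p y k = (if k = 0 then 1 else 0) - L2_inner P (gauss_deriv k y) p"

lemma deriv_seq_defect_seq:
  assumes "finite_measure P" "sets P = sets borel" "p \<in> L2_space P"
  shows "deriv_seq (defect_seq P p)"
  unfolding deriv_seq_def
proof (intro allI)
  fix y i
  have "((\<lambda>y. L2_inner P (gauss_deriv i y) p) has_real_derivative L2_inner P (gauss_deriv (Suc i) y) p) (at y)"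
    using deriv_seq_certificate[OF assms] unfolding deriv_seq_def by blast
  from DERIV_diff[OF DERIV_const this]
  show "((\<lambda>y. defect_seq P p y i) has_real_derivative defect_seq P p y (Suc i)) (at y)"
    unfolding defect_seq_def by simp
qed

text \<open>
  Multiplied by $e^{(y-c)^2}$, the defect becomes $e^{(y-c)^2}$ minus a superposition of exponentials
  $e^{2(s-c)(y-c)}$ with density \<open>p\<close>. The factor $D - 2(t-c)$ multiplies such an exponential by
  $2(s-t)$, so choosing the \<open>t\<close> at the sign changes of \<open>p\<close> makes the superposition contribute
  with a sign.
\<close>

lemma defect_operator_pos:
  assumes P: "finite_measure P" "sets P = sets borel" and p: "p \<in> L2_space P"
    and supp: "AE s in P. s \<in> {c - r..c + r}" and pf: "AE s in P. p s = f s"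
    and f: "continuous_on UNIV f" "\<not> alternates f (2 * M) 1 (c - r) (c + r)"
    and r: "0 \<le> r" "(1 + 2 * r) ^ (2 * M) < 2"
  shows "\<exists>ts. length ts = 2 * M
    \<and> (\<forall>y. 0 < fold dop ts (\<lambda>n. leibniz n (exp_square_seq c y) (defect_seq P p y)) 0)"
proof -
  obtain ts' where ts': "length ts' = 2 * M" "set ts' \<subseteq> {c - r..c + r}"
    "\<And>s. s \<in> {c - r..c + r} \<Longrightarrow> 1 * f s * (\<Prod>t\<leftarrow>ts'. t - s) \<le> 0"
    using sign_pattern[OF f(1) _ f(2)] r by auto
  \<comment> \<open>The factor 2 comes from the exponents 2(s-c); it is why the roots are bounded by
    2r and not by r.\<close>
  define ts where "ts = map (\<lambda>t. 2 * (t - c)) ts'"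
  have "0 < fold dop ts (\<lambda>n. leibniz n (exp_square_seq c y) (defect_seq P p y)) 0" for y
  proof -
    let ?E = "exp_square_seq c y"
    let ?k = "\<lambda>s. exp (2 * (s - c) * (y - c) - (s - c)\<^sup>2) * p s"
    have ig: "integrable P (\<lambda>s. gauss_deriv i y s * p s)" for i
      by (rule L2_space_integrable_mult[OF gauss_deriv_in_L2_space[OF P] p])
    have lg: "leibniz n ?E (\<lambda>k. gauss_deriv k y s * p s) = (2 * (s - c)) ^ n * ?k s" for n s
      by (simp add: leibniz_cmult leibniz_exp_square_gauss)
    have iu: "integrable P (\<lambda>s. (2 * (s - c)) ^ n * ?k s)" for n
      using leibniz_integral[of P "\<lambda>s k. gauss_deriv k y s * p s" n ?E, OF ig] lg by simp
    have "leibniz n ?E (defect_seq P p y) = ?E n - (LINT s|P. (2 * (s - c)) ^ n * ?k s)" for n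
      unfolding defect_seq_def leibniz_diff leibniz_const L2_inner_def
      using leibniz_integral[of P "\<lambda>s k. gauss_deriv k y s * p s" n ?E, OF ig] lg by simp
    then have "fold dop ts (\<lambda>n. leibniz n ?E (defect_seq P p y)) 0
        = fold dop ts ?E 0 - (LINT s|P. (\<Prod>t\<leftarrow>ts. 2 * (s - c) - t) * ?k s)"
      using fold_dop_integral[of P "\<lambda>s n. (2 * (s - c)) ^ n * ?k s" ts, OF iu]
      by (simp add: fold_dop_diff fold_dop_power)
    moreover have "0 < fold dop ts ?E 0"
      unfolding exp_square_seq_def
    proof (rule fold_dop_exp_square_pos[of _ M "2 * r"])
      show "\<bar>t\<bar> \<le> 2 * r" if "t \<in> set ts" for t
        using that ts'(2) by (fastforce simp: ts_def)
    qed (use r ts' in \<open>auto simp: ts_def\<close>)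
    moreover have "0 \<le> (LINT s|P. - ((\<Prod>t\<leftarrow>ts. 2 * (s - c) - t) * ?k s))"
    proof (rule integral_nonneg_AE)
      show "AE s in P. 0 \<le> - ((\<Prod>t\<leftarrow>ts. 2 * (s - c) - t) * ?k s)"
        using supp pf
      proof eventually_elim
        case (elim s)
        \<comment> \<open>Each factor is -2(t-s), and since their number is even the constants
          multiply to something positive.\<close>
        have "(\<Prod>t\<leftarrow>ts. 2 * (s - c) - t) = (\<Prod>t\<leftarrow>ts'. (- 2) * (t - s))"
          by (simp add: ts_def o_def algebra_simps)
        also have "\<dots> = (- 2) ^ length ts' * (\<Prod>t\<leftarrow>ts'. t - s)"
          by (induction ts') (simp_all add: algebra_simps)
        finally have "(\<Prod>t\<leftarrow>ts. 2 * (s - c) - t) * ?k s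
            = ((- 2) ^ (2 * M) * exp (2 * (s - c) * (y - c) - (s - c)\<^sup>2)) * (f s * (\<Prod>t\<leftarrow>ts'. t - s))"
          using elim(2) ts'(1) by (simp add: mult_ac)
        also have "\<dots> \<le> 0"
        proof (rule mult_nonneg_nonpos)
          show "f s * (\<Prod>t\<leftarrow>ts'. t - s) \<le> 0"
            using ts'(3)[OF elim(1)] unfolding mult_1_left .
        qed simp
        finally show ?case by simp
      qed
    qed
    ultimately show ?thesis by simp
  qed
  then show ?thesis using ts'(1) by (intro exI[of _ ts]) (simp add: ts_def)
qed

section \<open>Chebyshev systems\<close>

text \<open>The complement is a union of open null sets; by Lindelof countably many of them
  suffice.\<close>

lemma AE_in_measure_support:
  assumes "sets P = sets borel"
  shows "AE s in P. s \<in> measure_support P"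
proof -
  let ?F = "{U. open U \<and> emeasure P U = 0}"
  have "\<And>U. U \<in> ?F \<Longrightarrow> openin (top_of_set UNIV) U" by simp
  then obtain F where F: "F \<subseteq> ?F" "countable F" "\<Union>F = \<Union>?F"
    by (rule Lindelof_openin)
  have "(\<Union>U\<in>F. U) \<in> null_sets P"
    using F assms by (intro null_sets_UN') (auto simp: null_sets_def)
  moreover have "{s \<in> space P. s \<notin> measure_support P} \<subseteq> (\<Union>U\<in>F. U)"
    using F(3) by (auto simp: measure_support_def)
  ultimately show ?thesis by (rule AE_I')
qed

lemma continuous_AE_zero_on_support:
  assumes "sets P = sets borel" "continuous_on UNIV f" "AE s in P. f s = (0::real)"
    and "s \<in> measure_support P"
  shows "f s = 0"
proof (rule ccontr)
  assume "f s \<noteq> 0"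
  let ?U = "{s. f s \<noteq> 0}"
  have U: "open ?U" using assms(2) by (intro open_Collect_neq continuous_intros)
  then have "?U \<in> null_sets P"
    using assms(1,3) by (subst AE_iff_null_sets) auto
  then have "emeasure P ?U = 0" by (simp add: null_sets_def)
  then show False
    using assms(4) U \<open>f s \<noteq> 0\<close> by (auto simp: measure_support_def)
qed

text \<open>Finiteness of P is a consequence of the framework: the Gaussian is bounded below on the
  bounded support, so its square can be integrable only for finite mass.\<close>

lemma finite_measure_if_gaussian_in_L2_space:
  assumes "sets P = sets borel" "measure_support P \<subseteq> {c - r..c + r}" "gaussian_kernel x \<in> L2_space P"
  shows "finite_measure P"
proof -
  define d where "d = exp (- (\<bar>x - c\<bar> + r)\<^sup>2)"
  have d: "d > 0" by (simp add: d_def)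
  have int: "integrable P (\<lambda>s. (1 / d\<^sup>2) * (gaussian_kernel x s)\<^sup>2)"
    using assms(3) by (intro integrable_mult_right) (simp add: L2_space_def)
  have "integrable P (\<lambda>s. 1 :: real)"
  proof (rule Bochner_Integration.integrable_bound[OF int])
    show "AE s in P. norm (1 :: real) \<le> norm ((1 / d\<^sup>2) * (gaussian_kernel x s)\<^sup>2)"
      using AE_in_measure_support[OF assms(1)]
    proof eventually_elim
      case (elim s)
      then have "c - r \<le> s" "s \<le> c + r" using assms(2) by auto
      then have "\<bar>x - s\<bar> \<le> \<bar>\<bar>x - c\<bar> + r\<bar>" by linarith
      then have "(x - s)\<^sup>2 \<le> (\<bar>x - c\<bar> + r)\<^sup>2" by (simp add: abs_le_square_iff)
      then have "d \<le> gaussian_kernel x s" by (simp add: d_def gaussian_kernel_def)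
      then have "d\<^sup>2 \<le> (gaussian_kernel x s)\<^sup>2" using d by (intro power_mono) auto
      then show ?case using d by (simp add: field_simps)
    qed
  qed simp
  then have "emeasure P (space P) < \<infinity>" by (simp add: integrable_iff_bounded)
  then show ?thesis by (intro finite_measureI) simp
qed

text \<open>The Haar condition, stated through zeros instead of determinants.\<close>

definition chebyshev_system :: "nat \<Rightarrow> (nat \<Rightarrow> real \<Rightarrow> real) \<Rightarrow> bool" where
  "chebyshev_system n v \<longleftrightarrow> (\<forall>b A. finite A \<longrightarrow> n \<le> card A \<longrightarrow>
     (\<forall>s\<in>A. (\<Sum>j=1..n. b j * v j s) = 0) \<longrightarrow> (\<forall>j\<in>{1..n}. b j = 0))"

text \<open>n sign changes give n zeros, so all coefficients vanish, against the strict sign at the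
  first point.\<close>

lemma chebyshev_system_not_alternates:
  assumes "chebyshev_system n v" "\<And>j. continuous_on UNIV (v j)"
  shows "\<not> alternates (\<lambda>s. \<Sum>j=1..n. b j * v j s) n e l u"
proof
  assume alt: "alternates (\<lambda>s. \<Sum>j=1..n. b j * v j s) n e l u"
  have "continuous_on UNIV (\<lambda>s. \<Sum>j=1..n. b j * v j s)"
    using assms(2) by (intro continuous_intros)
  from alternates_zeros[OF this alt] obtain s A where s: "e * (\<Sum>j=1..n. b j * v j s) > 0"
    and A: "finite A" "card A = n" "\<forall>z\<in>A. (\<Sum>j=1..n. b j * v j z) = 0" by blast
  then have "\<forall>j\<in>{1..n}. b j = 0"
    using assms(1) unfolding chebyshev_system_def by blast
  then show False using s by simp
qed

text \<open>The place where the size of the support enters: a continuous combination that is zero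
  almost everywhere vanishes on the whole support, which has at least n points.\<close>

lemma chebyshev_system_L2_independent:
  assumes "chebyshev_system n v" "\<And>j. continuous_on UNIV (v j)" "sets P = sets borel"
    and supp: "infinite (measure_support P) \<or> n \<le> card (measure_support P)"
  shows "L2_independent P n v"
  unfolding L2_independent_def
proof (intro allI impI)
  fix b assume ae: "AE s in P. (\<Sum>j=1..n. b j * v j s) = 0"
  have cont: "continuous_on UNIV (\<lambda>s. \<Sum>j=1..n. b j * v j s)"
    using assms(2) by (intro continuous_intros)
  obtain A where A: "A \<subseteq> measure_support P" "finite A" "n \<le> card A"
  proof (cases "finite (measure_support P)")
    case True
    then show ?thesis using supp that by blast
  next
    case False
    then show ?thesis using infinite_arbitrarily_large[OF False, of n] that by auto
  qed
  have "\<forall>s\<in>A. (\<Sum>j=1..n. b j * v j s) = 0"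
    using continuous_AE_zero_on_support[OF assms(3) cont ae] A(1) by blast
  then show "\<forall>j\<in>{1..n}. b j = 0"
    using assms(1) A(2,3) unfolding chebyshev_system_def by blast
qed

lemma L2_full_rank_if_independent:
  assumes "L2_independent P n v" "\<And>b. AE s in P. T b s = (\<Sum>j=1..n. b j * v j s)"
  shows "L2_full_rank P n T"
  unfolding L2_full_rank_def
proof (intro allI impI)
  fix b c assume "AE s in P. T b s = T c s"
  then have "AE s in P. (\<Sum>j=1..n. (\<lambda>j. b j - c j) j * v j s) = 0"
    using assms(2)[of b] assms(2)[of c]
    by eventually_elim (simp add: left_diff_distrib sum_subtractf)
  then have "\<forall>j\<in>{1..n}. b j - c j = 0"
    using assms(1) unfolding L2_independent_def by (rule_tac mp[OF spec[of _ "\<lambda>j. b j - c j"]]) auto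
  then show "\<forall>j\<in>{1..n}. b j = c j" by simp
qed

section \<open>The systems attached to M nodes and to one point\<close>

text \<open>The columns of \<open>Gamma_op\<close> in its own numbering: positions 2i - 1 and 2i
  both belong to node i, and \<open>Suc j div 2\<close> recovers i from either.\<close>

definition spike_functions :: "(nat \<Rightarrow> real) \<Rightarrow> nat \<Rightarrow> real \<Rightarrow> real" where
  "spike_functions x j = gauss_deriv (if odd j then 0 else 1) (x (Suc j div 2))"

lemma sum_pairs:
  fixes g :: "nat \<Rightarrow> real"
  shows "(\<Sum>j=1..2 * M. g j) = (\<Sum>i=1..M. g (2 * i - 1) + g (2 * i))"
  by (induction M) simp_all

lemma sum_spike_functions:
  "(\<Sum>j=1..2 * M. b j * spike_functions x j s)
    = (\<Sum>i=1..M. b (2 * i - 1) * gauss_deriv 0 (x i) s + b (2 * i) * gauss_deriv 1 (x i) s)"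
  unfolding sum_pairs by (rule sum.cong) (auto simp: spike_functions_def)

text \<open>After the common factor $e^{-s^2}$ is removed, node i contributes a polynomial of degree
  at most 1 times $e^{2 x_i s}$, with distinct frequencies.\<close>

lemma chebyshev_system_spike_functions:
  assumes "strict_mono_on {1..M} x"
  shows "chebyshev_system (2 * M) (spike_functions x)"
  unfolding chebyshev_system_def
proof (intro allI impI)
  fix b A assume A: "finite A" "2 * M \<le> card A" "\<forall>s\<in>A. (\<Sum>j=1..2 * M. b j * spike_functions x j s) = 0"
  define Q where "Q = (\<lambda>i. smult (exp (- (x i)\<^sup>2)) [: b (2 * i - 1) - 2 * x i * b (2 * i), 2 * b (2 * i) :])"
  have eq: "b (2 * i - 1) * gauss_deriv 0 (x i) s + b (2 * i) * gauss_deriv 1 (x i) s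
      = exp (- s\<^sup>2) * (poly (Q i) s * exp (2 * x i * s))" for i s
  proof -
    have e: "exp (- (x i - s)\<^sup>2) = exp (- s\<^sup>2) * exp (- (x i)\<^sup>2) * exp (2 * x i * s)"
      unfolding exp_add[symmetric] by (rule arg_cong[of _ _ exp]) (simp add: power2_diff)
    show ?thesis unfolding gauss_deriv_def e Q_def by (simp add: algebra_simps)
  qed
  have "\<forall>i\<in>{1..M}. Q i = 0"
  proof (rule exp_poly_zeros[of _ "\<lambda>i. 2 * x i" _ "\<lambda>_. 2" A])
    show "inj_on (\<lambda>i. 2 * x i) {1..M}"
    proof (rule inj_onI)
      fix i j assume ij: "i \<in> {1..M}" "j \<in> {1..M}" "2 * x i = 2 * x j"
      then have "x i = x j" by simp
      then show "i = j" by (rule inj_onD[OF strict_mono_on_imp_inj_on[OF assms] _ ij(1,2)])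
    qed
    show "Q i = 0 \<or> degree (Q i) < 2" for i
    proof -
      have "degree (Q i) \<le> degree [: b (2 * i - 1) - 2 * x i * b (2 * i), 2 * b (2 * i) :]"
        unfolding Q_def by (rule degree_smult_le)
      also have "\<dots> \<le> 1" by (simp add: degree_pCons_le)
      finally show ?thesis by simp
    qed
    show "(\<Sum>i=1..M. poly (Q i) s * exp (2 * x i * s)) = 0" if "s \<in> A" for s
    proof -
      have "exp (- s\<^sup>2) * (\<Sum>i=1..M. poly (Q i) s * exp (2 * x i * s)) = 0"
        using A(3) that unfolding sum_spike_functions eq sum_distrib_left by blast
      then show ?thesis by simp
    qed
  qed (use A in auto)
  then have *: "b (2 * i - 1) = 0 \<and> b (2 * i) = 0" if "i \<in> {1..M}" for i
    using that by (auto simp: Q_def)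
  show "\<forall>j\<in>{1..2 * M}. b j = 0"
  proof
    fix j assume j: "j \<in> {1..2 * M}"
    show "b j = 0"
    proof (cases "even j")
      case True
      then show ?thesis using *[of "j div 2"] j by auto
    next
      case False
      then obtain k where "j = 2 * k + 1" by (rule oddE)
      then show ?thesis using *[of "Suc k"] j by auto
    qed
  qed
qed

lemma graded_poly_sum_zero:
  fixes q :: "nat \<Rightarrow> 'a :: idom poly"
  assumes "\<And>k. degree (q k) = k \<and> q k \<noteq> 0" "(\<Sum>k<n. smult (b k) (q k)) = 0"
  shows "\<forall>k<n. b k = 0"
  using assms(2)
proof (induction n)
  case (Suc n)
  have "coeff (\<Sum>k<n. smult (b k) (q k)) n = 0"
    unfolding coeff_sum using assms(1) by (intro sum.neutral) (simp add: coeff_eq_0)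
  then have "b n * coeff (q n) n = 0"
    using arg_cong[OF Suc.prems, of "\<lambda>p. coeff p n"] by simp
  moreover have "coeff (q n) n \<noteq> 0" using assms(1)[of n] by (metis leading_coeff_0_iff)
  ultimately have "b n = 0" by simp
  then show ?case using Suc by (simp add: less_Suc_eq)
qed simp

text \<open>Without the common Gaussian factor a combination is a polynomial in x0 - s of degree
  below n, and the Hermite polynomials are independent by their degrees. The shift
  \<open>j - 1\<close> matches numbering from 1 with orders from 0.\<close>

lemma chebyshev_system_jet:
  "chebyshev_system n (\<lambda>j. gauss_deriv (j - 1) x0)"
  unfolding chebyshev_system_def
proof (intro allI impI)
  fix b A assume A: "finite A" "n \<le> card A" "\<forall>s\<in>A. (\<Sum>j=1..n. b j * gauss_deriv (j - 1) x0 s) = 0"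
  let ?q = "exp_square_poly (- 1)"
  define p where "p = (\<Sum>k<n. smult (b (Suc k)) (?q k))"
  have peq: "poly p (x0 - s) * exp (- (x0 - s)\<^sup>2) = (\<Sum>j=1..n. b j * gauss_deriv (j - 1) x0 s)" for s
  proof -
    have "(\<Sum>j=1..n. b j * gauss_deriv (j - 1) x0 s) = (\<Sum>k<n. b (Suc k) * gauss_deriv k x0 s)"
      using sum.atLeast_Suc_atMost_Suc_shift[of "\<lambda>j. b j * gauss_deriv (j - 1) x0 s" 0 "n - 1"]
      by (cases n) (simp_all add: atLeast0AtMost lessThan_Suc_atMost)
    then show ?thesis
      by (simp add: p_def poly_sum gauss_deriv_def sum_distrib_right mult.assoc)
  qed
  have roots: "(\<lambda>s. x0 - s) ` A \<subseteq> {u. poly p u = 0}"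
  proof
    fix u assume "u \<in> (\<lambda>s. x0 - s) ` A"
    then obtain s where s: "s \<in> A" "u = x0 - s" by blast
    then have "poly p (x0 - s) * exp (- (x0 - s)\<^sup>2) = 0" using A(3) unfolding peq by blast
    then show "u \<in> {u. poly p u = 0}" using s by simp
  qed
  have "p = 0"
  proof (rule ccontr)
    assume p: "p \<noteq> 0"
    have "card A = card ((\<lambda>s. x0 - s) ` A)" by (rule card_image[symmetric]) (simp add: inj_on_def)
    also have "\<dots> \<le> card {u. poly p u = 0}" by (rule card_mono[OF poly_roots_finite[OF p] roots])
    also have "\<dots> \<le> degree p" by (rule card_poly_roots_bound[OF p])
    finally have "n \<le> degree p" using A(2) by simp
    moreover have "degree p < n" if "n > 0"
      unfolding p_def using that degree_exp_square_poly[of "- 1"]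
      by (intro degree_sum_less) (auto intro: le_less_trans[OF degree_smult_le])
    ultimately show False using p by (cases "n = 0") (auto simp: p_def)
  qed
  then have "\<forall>k<n. b (Suc k) = 0"
    unfolding p_def by (intro graded_poly_sum_zero[of ?q]) (auto simp: degree_exp_square_poly simp del: exp_square_poly.simps)
  then show "\<forall>j\<in>{1..n}. b j = 0"
    by (metis Suc_le_D Suc_le_lessD atLeastAtMost_iff One_nat_def)
qed

section \<open>The two certificates\<close>

text \<open>Both certificates are minimal norm solutions of 2M linear constraints given by a
  Chebyshev system. The sign argument sees only the span, so one statement with arbitrary right-hand
  sides \<open>d\<close> serves both.\<close>

lemma minimal_certificate_operator_pos:
  fixes d :: "nat \<Rightarrow> real"
  assumes P: "finite_measure P" "sets P = sets borel"
    and supp: "measure_support P \<subseteq> {c - r..c + r}"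
      "infinite (measure_support P) \<or> 2 * M \<le> card (measure_support P)"
    and r: "0 \<le> r" "(1 + 2 * r) ^ (2 * M) < 2"
    and v: "chebyshev_system (2 * M) v" "\<And>j. \<exists>k x. v j = gauss_deriv k x"
  defines "S \<equiv> {p \<in> L2_space P. \<forall>j\<in>{1..2 * M}. L2_inner P (v j) p = d j}"
  shows "arg_min_on (L2_norm P) S \<in> S"
    and "\<exists>ts. length ts = 2 * M \<and> (\<forall>y. 0 < fold dop ts
      (\<lambda>n. leibniz n (exp_square_seq c y) (defect_seq P (arg_min_on (L2_norm P) S) y)) 0)"
proof -
  have cont: "continuous_on UNIV (v j)" for j
    using v(2)[of j] continuous_gauss_deriv by metis
  have L2: "v j \<in> L2_space P" for j
    using v(2)[of j] gauss_deriv_in_L2_space[OF P] by metis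
  have ind: "L2_independent P (2 * M) v"
    by (rule chebyshev_system_L2_independent[OF v(1) cont P(2) supp(2)])
  note min = arg_min_L2_norm_in_span[of "2 * M" v P d, OF L2 ind, folded S_def]
  show pS: "arg_min_on (L2_norm P) S \<in> S" by (rule min(1))
  obtain b where b: "AE s in P. arg_min_on (L2_norm P) S s = (\<Sum>j=1..2 * M. b j * v j s)"
    using min(2) by blast
  show "\<exists>ts. length ts = 2 * M \<and> (\<forall>y. 0 < fold dop ts
      (\<lambda>n. leibniz n (exp_square_seq c y) (defect_seq P (arg_min_on (L2_norm P) S) y)) 0)"
  proof (rule defect_operator_pos[OF P _ _ b _ _ r])
    show "arg_min_on (L2_norm P) S \<in> L2_space P" using pS by (simp add: S_def)
    show "AE s in P. s \<in> {c - r..c + r}"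
      using AE_in_measure_support[OF P(2)] by eventually_elim (use supp(1) in blast)
    show "continuous_on UNIV (\<lambda>s. \<Sum>j=1..2 * M. b j * v j s)"
      using cont by (intro continuous_intros)
    show "\<not> alternates (\<lambda>s. \<Sum>j=1..2 * M. b j * v j s) (2 * M) 1 (c - r) (c + r)"
      by (rule chebyshev_system_not_alternates[OF v(1) cont])
  qed
qed

lemma NDSC_gaussian:
  assumes P: "finite_measure P" "sets P = sets borel" and X: "\<forall>x\<in>X. x islimpt X"
    and supp: "measure_support P \<subseteq> {c - r..c + r}"
      "infinite (measure_support P) \<or> 2 * M \<le> card (measure_support P)"
    and r: "0 \<le> r" "(1 + 2 * r) ^ (2 * M) < 2" and M: "M \<ge> 1"
    and x: "strict_mono_on {1..M} x" "\<forall>i\<in>{1..M}. x i \<in> interior X \<and> a i > 0"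
  shows "NDSC P X gaussian_kernel (spikes X M a x)"
proof -
  let ?v = "spike_functions x"
  define p where "p = p_V P gaussian_kernel M x"
  have sys: "chebyshev_system (2 * M) ?v" by (rule chebyshev_system_spike_functions[OF x(1)])
  \<comment> \<open>Odd positions prescribe the value 1 at a node, even ones the derivative
    0.\<close>
  define S where "S = {p \<in> L2_space P. \<forall>j\<in>{1..2 * M}. L2_inner P (?v j) p = (if odd j then 1 else 0)}"
  have constr: "(\<forall>i\<in>{1..M}. Phi_adj P gaussian_kernel p (x i) = 1
        \<and> deriv (Phi_adj P gaussian_kernel p) (x i) = 0)
      \<longleftrightarrow> (\<forall>j\<in>{1..2 * M}. L2_inner P (?v j) p = (if odd j then 1 else 0))" (is "?L \<longleftrightarrow> ?R")
    if p: "p \<in> L2_space P" for p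
  proof -
    have d: "Phi_adj P gaussian_kernel p (x i) = L2_inner P (gauss_deriv 0 (x i)) p"
      "deriv (Phi_adj P gaussian_kernel p) (x i) = L2_inner P (gauss_deriv 1 (x i)) p" for i
      using higher_deriv_certificate[OF P p, of 0] higher_deriv_certificate[OF P p, of 1] by simp_all
    show ?thesis unfolding d
    proof safe
      fix j assume L: "\<forall>i\<in>{1..M}. L2_inner P (gauss_deriv 0 (x i)) p = 1 \<and> L2_inner P (gauss_deriv 1 (x i)) p = 0"
        and j: "j \<in> {1..2 * M}"
      have "Suc j div 2 \<in> {1..M}" using j by auto
      then obtain i where i: "i \<in> {1..M}" "Suc j div 2 = i" by blast
      show "L2_inner P (?v j) p = (if odd j then 1 else 0)"
        using bspec[OF L i(1)] unfolding spike_functions_def i(2) by simp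
    next
      fix i assume R: ?R and i: "i \<in> {1..M}"
      have "2 * i - 1 \<in> {1..2 * M}" "2 * i \<in> {1..2 * M}" "Suc (2 * i - 1) div 2 = i" "odd (2 * i - 1)"
        using i by auto
      then show "L2_inner P (gauss_deriv 0 (x i)) p = 1" "L2_inner P (gauss_deriv 1 (x i)) p = 0"
        using R[rule_format, of "2 * i - 1"] R[rule_format, of "2 * i"]
        by (simp_all add: spike_functions_def)
    qed
  qed
  have pS: "p = arg_min_on (L2_norm P) S"
    unfolding p_def p_V_def S_def using constr by (intro arg_cong[of _ _ "arg_min_on (L2_norm P)"]) blast
  have v: "\<exists>k y. ?v j = gauss_deriv k y" for j unfolding spike_functions_def by blast
  note min = minimal_certificate_operator_pos[OF P supp r sys v, of "\<lambda>j. if odd j then 1 else 0", folded S_def, folded pS]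
  have p: "p \<in> L2_space P" using min(1) by (simp add: S_def)
  obtain ts where ts: "length ts = 2 * M"
    "\<And>y. 0 < fold dop ts (\<lambda>n. leibniz n (exp_square_seq c y) (defect_seq P p y)) 0"
    using min(2) by blast
  let ?G = "\<lambda>y n. leibniz n (exp_square_seq c y) (defect_seq P p y)"
  have G: "deriv_seq ?G"
    by (rule deriv_seq_leibniz[OF deriv_seq_exp_square_seq deriv_seq_defect_seq[OF P p]])
  have E: "0 < exp_square_seq c y 0" for y by (simp add: exp_square_seq_def)
  have eta: "(deriv ^^ k) (eta_V P gaussian_kernel M x) y = L2_inner P (gauss_deriv k y) p" for k y
    unfolding eta_V_def p_def[symmetric] higher_deriv_certificate[OF P p] ..
  have U: "defect_seq P p (x i) k = 0" if "i \<in> {1..M}" "k < 2" for i k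
  proof -
    have "\<forall>i\<in>{1..M}. Phi_adj P gaussian_kernel p (x i) = 1 \<and> deriv (Phi_adj P gaussian_kernel p) (x i) = 0"
      using constr[OF p] min(1) unfolding S_def by blast
    then show ?thesis
      using that higher_deriv_certificate[OF P p, of 0] higher_deriv_certificate[OF P p, of 1]
      by (auto simp: defect_seq_def less_2_cases_iff)
  qed
  have G0: "?G (x i) 0 = 0 \<and> ?G (x i) 1 = 0" if "i \<in> {1..M}" for i
    using leibniz_vanishing[of 1 "defect_seq P p (x i)" "exp_square_seq c (x i)"] U[OF that] by auto
  have "eta_V P gaussian_kernel M x y < 1" if "y \<notin> x ` {1..M}" for y
  proof -
    have "0 < ?G y 0" by (rule double_nodes_pos[OF G ts(2,1) x(1) G0 that M])
    then have "0 < defect_seq P p y 0" using E[of y] by (simp add: zero_less_mult_iff)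
    then show ?thesis using eta[of 0 y] by (simp add: defect_seq_def)
  qed
  moreover have "(deriv ^^ 2) (eta_V P gaussian_kernel M x) (x i) < 0" if i: "i \<in> {1..M}" for i
  proof -
    have "0 < ?G (x i) 2" by (rule double_nodes_second_deriv_pos[OF G ts(2,1) x(1) G0 i])
    \<comment> \<open>The defect has a double zero at the node, so of the product rule only the
      positive weight times its second derivative survives.\<close>
    also have "?G (x i) 2 = exp_square_seq c (x i) 0 * defect_seq P p (x i) 2"
      using U[OF i] by (intro leibniz_vanishing) auto
    finally have "0 < defect_seq P p (x i) 2" using E[of "x i"] by (simp add: zero_less_mult_iff)
    then show ?thesis unfolding eta by (simp add: defect_seq_def)
  qed
  moreover have "L2_full_rank P (2 * M) (Gamma_op P X gaussian_kernel M x)"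
  proof (rule L2_full_rank_if_independent[of _ _ ?v])
    have "continuous_on UNIV (?v j)" for j
      unfolding spike_functions_def by (rule continuous_gauss_deriv)
    then show "L2_independent P (2 * M) ?v"
      by (rule chebyshev_system_L2_independent[OF sys _ P(2) supp(2)])
    fix b
    have "AE s in P. \<forall>i\<in>{1..M}. L2_deriv P X gaussian_kernel (x i) s = gauss_deriv 1 (x i) s"
    proof (rule AE_finite_allI)
      fix i assume "i \<in> {1..M}"
      then have "x i \<in> X" using x(2) interior_subset by blast
      from L2_higher_deriv_gaussian(2)[OF P X this, of 1]
      show "AE s in P. L2_deriv P X gaussian_kernel (x i) s = gauss_deriv 1 (x i) s" by simp
    qed simp
    then show "AE s in P. Gamma_op P X gaussian_kernel M x b s = (\<Sum>j=1..2 * M. b j * ?v j s)"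
      unfolding sum_spike_functions Gamma_op_def gauss_deriv_0 by eventually_elim simp
  qed
  ultimately show ?thesis
    unfolding NDSC_def using x by blast
qed

lemma non_degenerate_point_gaussian:
  assumes P: "finite_measure P" "sets P = sets borel" and X: "\<forall>x\<in>X. x islimpt X"
    and supp: "measure_support P \<subseteq> {c - r..c + r}"
      "infinite (measure_support P) \<or> 2 * M \<le> card (measure_support P)"
    and r: "0 \<le> r" "(1 + 2 * r) ^ (2 * M) < 2" and M: "M \<ge> 1"
    and x0: "x0 \<in> interior X" and kc: "gaussian_kernel \<in> kernel_class k P X"
  shows "non_degenerate_point (2 * M - 1) P X gaussian_kernel x0"
proof -
  let ?v = "\<lambda>j. gauss_deriv (j - 1) x0"
  define p where "p = p_W P gaussian_kernel (2 * M - 1) x0"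
  have sys: "chebyshev_system (2 * M) ?v" by (rule chebyshev_system_jet)
  define S where "S = {p \<in> L2_space P. \<forall>j\<in>{1..2 * M}. L2_inner P (?v j) p = (if j = 1 then 1 else 0)}"
  have constr: "Phi_adj P gaussian_kernel p x0 = 1
        \<and> (\<forall>k\<in>{1..2 * M - 1}. (deriv ^^ k) (Phi_adj P gaussian_kernel p) x0 = 0)
      \<longleftrightarrow> (\<forall>j\<in>{1..2 * M}. L2_inner P (?v j) p = (if j = 1 then 1 else 0))" (is "?L \<longleftrightarrow> ?R")
    if p: "p \<in> L2_space P" for p
  proof -
    have d: "Phi_adj P gaussian_kernel p x0 = L2_inner P (gauss_deriv 0 x0) p"
      using higher_deriv_certificate[OF P p, of 0] by simp
    show ?thesis unfolding d higher_deriv_certificate[OF P p]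
    proof safe
      fix j assume L: "L2_inner P (gauss_deriv 0 x0) p = 1"
        "\<forall>k\<in>{1..2 * M - 1}. L2_inner P (gauss_deriv k x0) p = 0" and j: "j \<in> {1..2 * M}"
      show "L2_inner P (?v j) p = (if j = 1 then 1 else 0)"
      proof (cases "j = 1")
        case False
        then have "j - 1 \<in> {1..2 * M - 1}" using j by auto
        then show ?thesis using L(2) False by simp
      qed (use L in simp)
    next
      assume R: ?R
      show "L2_inner P (gauss_deriv 0 x0) p = 1" using R[rule_format, of 1] M by simp
      fix k assume k: "k \<in> {1..2 * M - 1}"
      then have "Suc k \<in> {1..2 * M}" by auto
      then show "L2_inner P (gauss_deriv k x0) p = 0" using R[rule_format, of "Suc k"] k by simp
    qed
  qed
  have pS: "p = arg_min_on (L2_norm P) S"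
    unfolding p_def p_W_def S_def using constr by (intro arg_cong[of _ _ "arg_min_on (L2_norm P)"]) blast
  have v: "\<exists>k y. ?v j = gauss_deriv k y" for j by blast
  note min = minimal_certificate_operator_pos[OF P supp r sys v, of "\<lambda>j. if j = 1 then 1 else 0", folded S_def, folded pS]
  have p: "p \<in> L2_space P" using min(1) by (simp add: S_def)
  obtain ts where ts: "length ts = 2 * M"
    "\<And>y. 0 < fold dop ts (\<lambda>n. leibniz n (exp_square_seq c y) (defect_seq P p y)) 0"
    using min(2) by blast
  let ?G = "\<lambda>y n. leibniz n (exp_square_seq c y) (defect_seq P p y)"
  have G: "deriv_seq ?G"
    by (rule deriv_seq_leibniz[OF deriv_seq_exp_square_seq deriv_seq_defect_seq[OF P p]])
  have E: "0 < exp_square_seq c y 0" for y by (simp add: exp_square_seq_def)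
  have eta: "(deriv ^^ k) (eta_W P gaussian_kernel (2 * M - 1) x0) y = L2_inner P (gauss_deriv k y) p" for k y
    unfolding eta_W_def p_def[symmetric] higher_deriv_certificate[OF P p] ..
  have U: "defect_seq P p x0 k = 0" if "k < 2 * M" for k
  proof -
    have "\<forall>j\<in>{1..2 * M}. L2_inner P (?v j) p = (if j = 1 then 1 else 0)"
      using min(1) unfolding S_def by blast
    from bspec[OF this, of "Suc k"] show ?thesis
      using that by (auto simp: defect_seq_def split: if_splits)
  qed
  have G0: "?G x0 k = 0" if "k < 2 * M" for k
    using leibniz_vanishing[of k "defect_seq P p x0" "exp_square_seq c x0"] U that by simp
  have "eta_W P gaussian_kernel (2 * M - 1) x0 y < 1" if "y \<noteq> x0" for y
  proof -
    \<comment> \<open>The zero at \<open>x0\<close> has even order 2M, so the sign on the left is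
      the one on the right.\<close>
    have "0 < ?G y 0"
      using single_node_sign[OF G ts(2), of x0 y] G0 ts(1) that by (cases "x0 < y") auto
    then have "0 < defect_seq P p y 0" using E[of y] by (simp add: zero_less_mult_iff)
    then show ?thesis using eta[of 0 y] by (simp add: defect_seq_def)
  qed
  moreover have "(deriv ^^ (2 * M)) (eta_W P gaussian_kernel (2 * M - 1) x0) x0 < 0"
  proof -
    \<comment> \<open>All lower derivatives vanish at \<open>x0\<close>, so the strict sign of the
      operator there is that of the 2M-th derivative.\<close>
    have "fold dop ts (?G x0) 0 = ?G x0 (2 * M)"
      using fold_dop_vanishing[of ts "?G x0"] G0 ts(1) by simp
    also have "\<dots> = exp_square_seq c x0 0 * defect_seq P p x0 (2 * M)"
      using U by (intro leibniz_vanishing) auto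
    finally have "0 < exp_square_seq c x0 0 * defect_seq P p x0 (2 * M)" using ts(2)[of x0] by simp
    then have "0 < defect_seq P p x0 (2 * M)" using E[of x0] by (simp add: zero_less_mult_iff)
    then show ?thesis unfolding eta using M by (simp add: defect_seq_def)
  qed
  moreover have "L2_full_rank P (2 * M) (F_op P X gaussian_kernel (2 * M - 1) x0)"
  proof (rule L2_full_rank_if_independent[of _ _ ?v])
    show "L2_independent P (2 * M) ?v"
      by (rule chebyshev_system_L2_independent[OF sys continuous_gauss_deriv P(2) supp(2)])
    fix b
    have "x0 \<in> X" using x0 interior_subset by blast
    then have "AE s in P. \<forall>k\<in>{0..2 * M - 1}. L2_higher_deriv P X k gaussian_kernel x0 s = gauss_deriv k x0 s"
      by (intro AE_finite_allI L2_higher_deriv_gaussian(2)[OF P X]) auto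
    then show "AE s in P. F_op P X gaussian_kernel (2 * M - 1) x0 b s = (\<Sum>j=1..2 * M. b j * ?v j s)"
    proof eventually_elim
      case (elim s)
      have "(\<Sum>j=1..2 * M. b j * ?v j s) = (\<Sum>j=Suc 0..Suc (2 * M - 1). b j * ?v j s)"
        using M by simp
      also have "\<dots> = (\<Sum>k=0..2 * M - 1. b (Suc k) * gauss_deriv k x0 s)"
        by (subst sum.atLeast_Suc_atMost_Suc_shift) simp
      finally show ?case using elim by (simp add: F_op_def)
    qed
  qed
  moreover have "gaussian_kernel \<in> kernel_class (2 * M) P X"
    by (rule gaussian_in_kernel_class[OF P X kc])
  ultimately show ?thesis
    unfolding non_degenerate_point_def using M by simp
qed

theorem proposition5:
  fixes M :: nat and X :: "real set" and s_star :: real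
  assumes "M \<ge> 1" and "is_interval X"
  shows "\<exists>r>0. \<forall>P :: real measure.
    sets P = sets borel \<longrightarrow>
    (infinite (measure_support P) \<or> card (measure_support P) \<ge> 2 * M) \<longrightarrow>
    measure_support P \<subseteq> {s_star - r..s_star + r} \<longrightarrow>
    (\<exists>k\<ge>2. gaussian_kernel \<in> kernel_class k P X) \<longrightarrow>
      (\<forall>a x. strict_mono_on {1..M} x \<longrightarrow>
         (\<forall>i\<in>{1..M}. x i \<in> interior X \<and> a i > 0) \<longrightarrow>
         NDSC P X gaussian_kernel (spikes X M a x)) \<and>
      (\<forall>x0\<in>interior X. non_degenerate_point (2 * M - 1) P X gaussian_kernel x0)"
proof -
  \<comment> \<open>By $1 + 2r \<le> e^{2r}$ the power $(1+2r)^{2M}$ is at most $e^{4Mr}$, which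
    this choice makes equal to $e^{(ln 2)/2} < 2$.\<close>
  define r where "r = ln 2 / (8 * real M)"
  have r: "0 < r" using assms(1) by (simp add: r_def)
  have "(1 + 2 * r) ^ (2 * M) \<le> exp (2 * r) ^ (2 * M)"
    using r by (intro power_mono exp_ge_add_one_self) auto
  also have "\<dots> = exp (ln 2 / 2)"
    using assms(1) by (simp add: exp_of_nat_mult[symmetric] r_def)
  also have "\<dots> < exp (ln 2)" by (subst exp_less_cancel_iff) simp
  finally have r2: "(1 + 2 * r) ^ (2 * M) < 2" by simp
  \<comment> \<open>Each conclusion comes with an interior point of X (the first node, as M is
    positive). It supplies a point where the kernel is square-integrable and shows that X is not a
    single point, so that L2 derivatives are unique.\<close>
  have prep: "finite_measure P" "\<forall>x\<in>X. x islimpt X"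
    if P: "sets P = sets borel" and supp: "measure_support P \<subseteq> {s_star - r..s_star + r}"
      and kc: "gaussian_kernel \<in> kernel_class k P X" and x0: "x0 \<in> interior X" for P k x0
  proof -
    have "x0 \<in> X" using x0 interior_subset by blast
    then have "L2_higher_deriv P X 0 gaussian_kernel x0 \<in> L2_space P"
      using kc unfolding kernel_class_def L2_C_def by blast
    then show "finite_measure P"
      using finite_measure_if_gaussian_in_L2_space[OF P supp, of x0] by simp
    have "X \<noteq> {x}" for x using x0 by auto
    then show "\<forall>x\<in>X. x islimpt X"
      using connected_imp_perfect is_interval_connected[OF assms(2)] by blast
  qed
  show ?thesis
  proof (intro exI[of _ r] conjI allI impI ballI r)
    fix P :: "real measure" and a x :: "nat \<Rightarrow> real"
    assume P: "sets P = sets borel" and card: "infinite (measure_support P) \<or> 2 * M \<le> card (measure_support P)"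
      and supp: "measure_support P \<subseteq> {s_star - r..s_star + r}"
      and kc: "\<exists>k\<ge>2. gaussian_kernel \<in> kernel_class k P X"
      and x: "strict_mono_on {1..M} x" "\<forall>i\<in>{1..M}. x i \<in> interior X \<and> a i > 0"
    obtain k where k: "gaussian_kernel \<in> kernel_class k P X" using kc by blast
    have "x 1 \<in> interior X" using x(2) assms(1) by simp
    note prep = prep[OF P supp k this]
    show "NDSC P X gaussian_kernel (spikes X M a x)"
      by (rule NDSC_gaussian[OF prep(1) P prep(2) supp card less_imp_le[OF r] r2 assms(1) x])
  next
    fix P :: "real measure" and x0
    assume P: "sets P = sets borel" and card: "infinite (measure_support P) \<or> 2 * M \<le> card (measure_support P)"
      and supp: "measure_support P \<subseteq> {s_star - r..s_star + r}"
      and kc: "\<exists>k\<ge>2. gaussian_kernel \<in> kernel_class k P X"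
      and x0: "x0 \<in> interior X"
    obtain k where k: "gaussian_kernel \<in> kernel_class k P X" using kc by blast
    note prep = prep[OF P supp k x0]
    show "non_degenerate_point (2 * M - 1) P X gaussian_kernel x0"
      by (rule non_degenerate_point_gaussian[OF prep(1) P prep(2) supp card less_imp_le[OF r] r2 assms(1) x0 k])
  qed
qed

end
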